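(* Let $h$ be a transcendental entire function with $h(1)\neq 0$ and $h(-1)\neq 0$. For $a\in\mathbb{C}$ put $H_a(z):=\cos z\cdot h(\sin z)+a\sin z$. Then the set $\{a\in\mathbb{C}: H_a \text{ is not prime in the entire sense}\}$ is at most countable.
   Context: An entire function $F$ is prime in the entire sense if whenever $F=f\circ g$ with $f,g$ entire, either $f$ is linear or $g$ is linear. *)

theory Defs
  imports "HOL-Complex_Analysis.Complex_Analysis" "HOL-Computational_Algebra.Polynomial"
begin

definition entire :: "(complex \<Rightarrow> complex) \<Rightarrow> bool" where
  "entire f \<longleftrightarrow> f holomorphic_on UNIV"

definition transcendental_entire :: "(complex \<Rightarrow> complex) \<Rightarrow> bool" where
  "transcendental_entire f \<longleftrightarrow> entire f \<and> \<not> (\<exists>p :: complex poly. \<forall>z. f z = poly p z)"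

definition linear_fun :: "(complex \<Rightarrow> complex) \<Rightarrow> bool" where
  "linear_fun f \<longleftrightarrow> (\<exists>a b. a \<noteq> 0 \<and> (\<forall>z. f z = a * z + b))"

definition prime_entire :: "(complex \<Rightarrow> complex) \<Rightarrow> bool" where
  "prime_entire F \<longleftrightarrow>
     (\<forall>f g. entire f \<and> entire g \<and> F = f \<circ> g \<longrightarrow> linear_fun f \<or> linear_fun g)"

end

theory Submission
  imports Defs "HOL-Computational_Algebra.Fundamental_Theorem_Algebra"
begin

text \<open>
  Write \<open>F z = cos z * h (sin z) + a * sin z\<close>.  Outside a countable set of \<open>a\<close>, critical points of \<open>F\<close>
  with equal critical values are congruent modulo \<open>2 \<pi>\<close>, and \<open>F z + F (\<pi> - z) = 2 a sin z\<close> shows, via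
  the great Picard theorem in the variable \<open>exp (i z)\<close>, that \<open>F\<close> takes every value and \<open>F'\<close> the
  value 0 at points with arbitrarily large \<open>\<bar>Im z\<bar>\<close>.  Let \<open>F = f \<circ> g\<close>.  The fibre
  of \<open>g\<close> over a zero of \<open>f'\<close> lies in one class modulo \<open>2 \<pi>\<close>.
  \<^item> If \<open>g\<close> is a polynomial of degree at least 2, Vieta's formula for such a fibre fixes the imaginary part of
    all critical points of \<open>F\<close>.
  \<^item> If \<open>g\<close> is transcendental and \<open>f'\<close> has two zeros, one of the two fibres is infinite; as \<open>f (g (z + 2 \<pi> k)) = F z\<close>
    does not depend on \<open>k\<close>, Schottky's theorem and a pigeonhole argument make \<open>g\<close> periodic.
    Then \<open>g\<close> has poles at both ends of the cylinder, and critical points far up share their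
    \<open>g\<close>-value with points far down.
  \<^item> If \<open>f' w = (w - w0) ^ n * exp (M w)\<close> with \<open>M\<close> nonconstant, then \<open>F' z - F' (\<pi> - z) = 2 a cos z\<close> is an identity
    of Borel type, which forces \<open>M \<circ> g\<close> to grow at most linearly.  If \<open>M\<close> is constant, all solutions of
    \<open>F z = f w0\<close> are critical points.
\<close>

section \<open>Coinciding critical values\<close>

text \<open>What is available is a symmetry: under \<open>z \<mapsto> \<pi> - z\<close> the cosine
  changes sign and the sine does not, so the uncontrolled summand \<open>cos z * h (sin z)\<close>
  cancels and a function of exponential type remains. It exchanges the upper and lower half planes,
  hence the absolute value in \<open>\<bar>Im z\<bar>\<close>. At \<open>a = 0\<close> the identity
  degenerates, so 0 joins the exceptional set. Zeros of \<open>h\<close> at 1 or -1 would create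
  points that are critical for every \<open>a\<close>; they are the zeros of the cosine, where the
  parameter cannot be recovered from the critical point. In the Borel-type step the loss in passing
  from one disc to a smaller one is made explicit, and infinitely many discs are nested between the
  radii \<open>R\<close> and \<open>2 R\<close>. This gives a bound for every radius, with no
  exceptional set of radii.\<close>

lemma uncountable_imp_islimpt:
  fixes E :: "'a :: second_countable_topology set"
  assumes "uncountable E"
  obtains x where "x \<in> E" "x islimpt E"
proof (rule ccontr)
  assume "\<not> thesis"
  hence iso: "\<forall>x\<in>E. \<not> x islimpt E"
    using that by blast
  obtain B :: "'a set set" where B: "countable B" "topological_basis B"
    using ex_countable_basis by blast
  \<comment> \<open>A basic open set that isolates \<open>x\<close> within \<open>E\<close>
    determines \<open>x\<close>, and there are only countably many basic open sets.\<close>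
  have "\<exists>b\<in>B. x \<in> b \<and> b \<inter> E \<subseteq> {x}" if xE: "x \<in> E" for x
  proof -
    obtain T where T: "x \<in> T" "open T" "\<forall>y\<in>E. y \<in> T \<longrightarrow> y = x"
      using iso[rule_format, OF xE] by (auto simp: islimpt_def)
    then obtain b where "b \<in> B" "x \<in> b" "b \<subseteq> T"
      using B(2) topological_basisE by blast
    thus ?thesis using T by blast
  qed
  then obtain b where b: "\<And>x. x \<in> E \<Longrightarrow> b x \<in> B \<and> x \<in> b x \<and> b x \<inter> E \<subseteq> {x}"
    by metis
  hence "inj_on b E"
    by (intro inj_onI) blast
  moreover have "countable (b ` E)"
    using b B(1) by (meson countable_subset image_subsetI)
  ultimately show False
    using assms countable_image_inj_on by blast
qed

text \<open>Near \<open>z0\<close> the quotient \<open>f / g\<close> has derivative 0; the identity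
  theorem carries the proportionality past the zeros of \<open>g\<close>.\<close>

lemma holomorphic_wronskian_zero_imp_proportional:
  assumes f: "f holomorphic_on UNIV" and g: "g holomorphic_on UNIV"
    and W: "\<And>z. deriv f z * g z = f z * deriv g z" and z0: "g z0 \<noteq> 0"
  shows "f z = f z0 / g z0 * g z"
proof -
  have "continuous_on UNIV g"
    using g holomorphic_on_imp_continuous_on by blast
  then obtain r where r: "r > 0" "\<And>z. z \<in> ball z0 r \<Longrightarrow> g z \<noteq> 0"
    using continuous_at_avoid[of z0 g 0] z0
    by (metis (no_types, lifting) UNIV_I continuous_on_eq_continuous_at dist_commute mem_ball open_UNIV)
  have "((\<lambda>z. f z / g z) has_field_derivative 0) (at z within ball z0 r)" if "z \<in> ball z0 r" for z
  proof -
    have "((\<lambda>z. f z / g z) has_field_derivative (deriv f z * g z - f z * deriv g z) / (g z * g z)) (at z)"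
      using r(2)[OF that] f g
      by (intro DERIV_divide) (auto simp: holomorphic_derivI)
    thus ?thesis
      by (simp add: W has_field_derivative_at_within)
  qed
  hence "(\<lambda>z. f z / g z) constant_on ball z0 r"
    using has_field_derivative_zero_constant[of "ball z0 r" "\<lambda>z. f z / g z"] 
    by (auto simp: constant_on_def)
  then obtain c where c: "\<And>z. z \<in> ball z0 r \<Longrightarrow> f z / g z = c"
    by (auto simp: constant_on_def)
  have "c = f z0 / g z0" using c[of z0] r(1) by simp
  have "f z = c * g z"
  proof (rule analytic_continuation_open[of "ball z0 r" UNIV f "\<lambda>z. c * g z"])
    show "f z = c * g z" if "z \<in> ball z0 r" for z
      using c[OF that] r(2)[OF that] by (simp add: field_simps)
  qed (use r(1) f g in \<open>auto intro!: holomorphic_intros\<close>)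
  thus ?thesis using \<open>c = _\<close> by simp
qed

text \<open>
  Along the branch \<open>a \<mapsto> p(a)\<close> of critical points the critical value has
  derivative \<open>s (p(a))\<close>, so two branches with the same critical values satisfy \<open>s p = s q\<close>.
\<close>
lemma countable_coinciding_critical_values:
  fixes \<psi> s :: "complex \<Rightarrow> complex"
  assumes \<psi>: "\<psi> holomorphic_on UNIV" and s: "s holomorphic_on UNIV"
    and nonprop: "deriv (deriv \<psi>) z0 * deriv s z0 \<noteq> deriv \<psi> z0 * deriv (deriv s) z0"
  shows "countable {a. \<exists>p q. \<psi> p + a * s p = \<psi> q + a * s q
           \<and> deriv \<psi> p + a * deriv s p = 0 \<and> deriv \<psi> q + a * deriv s q = 0
           \<and> deriv s p \<noteq> 0 \<and> deriv s q \<noteq> 0 \<and> s p \<noteq> s q}" (is "countable ?B")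
proof -
  \<comment> \<open>Where \<open>deriv s z \<noteq> 0\<close>, the value \<open>\<phi> z\<close> is
    the only parameter for which \<open>z\<close> is critical, and \<open>\<phi>\<close> has
    derivative \<open>- W z / (deriv s z)\<^sup>2\<close>. Discarding the countably many
    \<open>\<phi>\<close>-values at zeros of \<open>W\<close> leaves nondegenerate critical
    points.\<close>
  define W where "W z = deriv (deriv \<psi>) z * deriv s z - deriv \<psi> z * deriv (deriv s) z" for z
  define \<phi> where "\<phi> z = - deriv \<psi> z / deriv s z" for z
  have hol: "deriv \<psi> holomorphic_on UNIV" "deriv s holomorphic_on UNIV"
    using \<psi> s holomorphic_deriv by blast+
  have holW: "W holomorphic_on UNIV"
    unfolding W_def using \<psi> s by (intro holomorphic_intros) auto
  have "countable {z. W z = 0}"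
  proof -
    have "countable {z. W z = 0}" if "\<not> W constant_on UNIV"
      using holomorphic_countable_zeros[OF holW open_UNIV connected_UNIV _ that]
      by (simp add: fsigma_UNIV)
    moreover have "{z. W z = 0} = {}" if "W constant_on UNIV"
      using that nonprop unfolding constant_on_def by (metis (mono_tags, lifting) UNIV_I W_def empty_Collect_eq right_minus_eq)
    ultimately show ?thesis by fastforce
  qed
  hence N: "countable (\<phi> ` {z. W z = 0})" by blast
  define C where "C = ?B - \<phi> ` {z. W z = 0}"
  have "countable C"
  proof (rule ccontr)
    assume unc: "uncountable C"
    have *: "\<exists>p q. \<psi> p + a * s p = \<psi> q + a * s q \<and> \<phi> p = a \<and> \<phi> q = a
           \<and> deriv s p \<noteq> 0 \<and> deriv s q \<noteq> 0 \<and> s p \<noteq> s q \<and> W p \<noteq> 0 \<and> W q \<noteq> 0" if a: "a \<in> C" for a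
    proof -
      from a obtain p q where pq: "\<psi> p + a * s p = \<psi> q + a * s q"
        "deriv \<psi> p + a * deriv s p = 0" "deriv \<psi> q + a * deriv s q = 0"
        "deriv s p \<noteq> 0" "deriv s q \<noteq> 0" "s p \<noteq> s q" 
        unfolding C_def by blast
      have "\<phi> p = a" "\<phi> q = a"
        using pq(2-5) by (auto simp: \<phi>_def field_simps add_eq_0_iff)
      moreover have "\<phi> z \<noteq> a" if "W z = 0" for z using a that unfolding C_def by blast
      hence "W p \<noteq> 0" "W q \<noteq> 0" using \<open>\<phi> p = a\<close> \<open>\<phi> q = a\<close> by metis+
      ultimately show ?thesis using pq by (intro exI[of _ p] exI[of _ q]) simp
    qed
    define R where "R a p q \<longleftrightarrow> \<psi> p + a * s p = \<psi> q + a * s q \<and> \<phi> p = a \<and> \<phi> q = a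
           \<and> deriv s p \<noteq> 0 \<and> deriv s q \<noteq> 0 \<and> s p \<noteq> s q \<and> W p \<noteq> 0 \<and> W q \<noteq> 0" for a p q
    define P where "P a = (SOME p. \<exists>q. R a p q)" for a
    define Q where "Q a = (SOME q. R a (P a) q)" for a
    have PQ: "R a (P a) (Q a)" if "a \<in> C" for a
    proof -
      have "\<exists>p q. R a p q" unfolding R_def by (rule *[OF that])
      hence "\<exists>q. R a (P a) q" unfolding P_def by (rule someI_ex)
      thus ?thesis unfolding Q_def by (rule someI_ex)
    qed
    note PQ = PQ[unfolded R_def]
    have "\<phi> (P a) = a" if "a \<in> C" for a using PQ[OF that] by simp
    \<comment> \<open>\<open>\<phi> \<circ> fst\<close> is a left inverse, so there are uncountably
      many pairs and one of them is a limit of others. A convergent sequence of arbitrarily chosen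
      pairs thus replaces continuous branches of critical points.\<close>
    hence "inj_on (\<lambda>a. (P a, Q a)) C"
      by (intro inj_on_inverseI[of _ "\<lambda>x. \<phi> (fst x)"]) simp
    hence "uncountable ((\<lambda>a. (P a, Q a)) ` C)"
      using unc by (metis countable_image_inj_on)
    then obtain x where x: "x \<in> (\<lambda>a. (P a, Q a)) ` C" "x islimpt (\<lambda>a. (P a, Q a)) ` C"
      by (rule uncountable_imp_islimpt)
    from x(1) obtain a0 where a0: "x = (P a0, Q a0)" "a0 \<in> C" by (rule imageE)
    define p q where "p = P a0" and "q = Q a0"
    from x(2)[unfolded islimpt_sequential]
    obtain y where y: "\<forall>n. y n \<in> (\<lambda>a. (P a, Q a)) ` C - {x}" "y \<longlonglongrightarrow> x" by (elim exE conjE)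
    have "\<exists>a. a \<in> C \<and> y n = (P a, Q a)" for n
      using y(1)[rule_format, of n] by auto
    then obtain b where b: "\<And>n. b n \<in> C" "\<And>n. y n = (P (b n), Q (b n))"
      by metis
    have lim: "(\<lambda>n. P (b n)) \<longlonglongrightarrow> p" "(\<lambda>n. Q (b n)) \<longlonglongrightarrow> q"
      using tendsto_fst[OF y(2)] tendsto_snd[OF y(2)] by (simp_all add: b(2) a0(1) p_def q_def)
    have bne: "b n \<noteq> a0" for n
      using y(1)[rule_format, of n] a0(1) b(2)[of n] by auto
    \<comment> \<open>As \<open>v\<close> is critical for \<open>a0\<close>, the numerator is small
      compared with \<open>X (b n) - v\<close>, whereas \<open>b n - a0\<close> is comparable with
      it because \<open>W v \<noteq> 0\<close>.\<close>
    have key: "(\<lambda>n. (\<psi> (X (b n)) + a0 * s (X (b n)) - (\<psi> v + a0 * s v)) / (b n - a0)) \<longlonglongrightarrow> 0"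
      if v: "v = X a0" and Xl: "(\<lambda>n. X (b n)) \<longlonglongrightarrow> v" and X: "\<And>a. a \<in> C \<Longrightarrow> \<phi> (X a) = a"
        and nz: "deriv s v \<noteq> 0" "W v \<noteq> 0" for X v
    proof -
      have ne: "X (b n) \<noteq> v" for n
        using X[OF b(1)[of n]] X[OF a0(2)] bne[of n] v by auto
      have fl: "filterlim (\<lambda>n. X (b n)) (at v) sequentially"
        using Xl ne by (auto simp: filterlim_at)
      have "- deriv \<psi> v = a0 * deriv s v"
        using X[OF a0(2)] nz v by (auto simp: \<phi>_def field_simps)
      from this[symmetric] have crit: "deriv \<psi> v + a0 * deriv s v = 0" by simp
      have "((\<lambda>z. \<psi> z + a0 * s z) has_field_derivative (deriv \<psi> v + a0 * deriv s v)) (at v)"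
        using \<psi> s by (auto intro!: derivative_eq_intros holomorphic_derivI)
      hence "((\<lambda>z. ((\<psi> z + a0 * s z) - (\<psi> v + a0 * s v)) / (z - v)) \<longlongrightarrow> 0) (at v)"
        by (simp add: crit has_field_derivative_iff)
      from filterlim_compose[OF this fl]
      have l1: "(\<lambda>n. (\<psi> (X (b n)) + a0 * s (X (b n)) - (\<psi> v + a0 * s v)) / (X (b n) - v)) \<longlonglongrightarrow> 0" .
      have "(\<phi> has_field_derivative ((- deriv (deriv \<psi>) v) * deriv s v - (- deriv \<psi> v) * deriv (deriv s) v) / (deriv s v * deriv s v)) (at v)"
        unfolding \<phi>_def using hol nz
        by (intro DERIV_divide derivative_intros) (auto intro!: holomorphic_derivI)
      also have "((- deriv (deriv \<psi>) v) * deriv s v - (- deriv \<psi> v) * deriv (deriv s) v) / (deriv s v * deriv s v)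
          = - W v / (deriv s v)\<^sup>2" by (simp add: W_def power2_eq_square field_simps)
      finally have "((\<lambda>z. (\<phi> z - \<phi> v) / (z - v)) \<longlongrightarrow> - W v / (deriv s v)\<^sup>2) (at v)"
        by (simp add: has_field_derivative_iff)
      from filterlim_compose[OF this fl]
      have "(\<lambda>n. (\<phi> (X (b n)) - \<phi> v) / (X (b n) - v)) \<longlonglongrightarrow> - W v / (deriv s v)\<^sup>2" .
      moreover have "\<phi> (X (b n)) = b n" "\<phi> v = a0" for n
        using X b(1) a0(2) v by auto
      ultimately have l2: "(\<lambda>n. (b n - a0) / (X (b n) - v)) \<longlonglongrightarrow> - W v / (deriv s v)\<^sup>2" by simp
      have "- W v / (deriv s v)\<^sup>2 \<noteq> 0" using nz by simp
      from tendsto_divide[OF l1 l2 this] show ?thesis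
        by (rule filterlim_cong[THEN iffD1, rotated -1]) (use ne in \<open>auto simp: bne\<close>)
    qed
    have p: "deriv s p \<noteq> 0" "W p \<noteq> 0" and q: "deriv s q \<noteq> 0" "W q \<noteq> 0" and sne: "s p \<noteq> s q"
      and eq0: "\<psi> p + a0 * s p = \<psi> q + a0 * s q"
      using PQ[OF a0(2)] by (auto simp: p_def q_def)
    have "(\<lambda>n. (\<psi> (P (b n)) + a0 * s (P (b n)) - (\<psi> p + a0 * s p)) / (b n - a0)
         - (\<psi> (Q (b n)) + a0 * s (Q (b n)) - (\<psi> q + a0 * s q)) / (b n - a0)) \<longlonglongrightarrow> 0 - 0"
      using PQ by (intro tendsto_diff key lim p q) (auto simp: p_def q_def)
    \<comment> \<open>The critical values agree for the parameter \<open>b n\<close> and for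
      \<open>a0\<close>; after subtraction only the change of parameter times the difference of the
      \<open>s\<close>-values is left.\<close>
    moreover have "(\<psi> (P (b n)) + a0 * s (P (b n)) - (\<psi> p + a0 * s p)) / (b n - a0)
         - (\<psi> (Q (b n)) + a0 * s (Q (b n)) - (\<psi> q + a0 * s q)) / (b n - a0) = s (Q (b n)) - s (P (b n))" for n
    proof -
      have "\<psi> (P (b n)) = \<psi> (Q (b n)) + b n * s (Q (b n)) - b n * s (P (b n))"
        using PQ[OF b(1)[of n]] by (auto simp: algebra_simps)
      hence "(\<psi> (P (b n)) + a0 * s (P (b n)) - (\<psi> p + a0 * s p))
         - (\<psi> (Q (b n)) + a0 * s (Q (b n)) - (\<psi> q + a0 * s q)) = (b n - a0) * (s (Q (b n)) - s (P (b n)))"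
        using eq0 by (simp add: algebra_simps)
      thus ?thesis using bne[of n] 
        by (simp add: diff_divide_distrib[symmetric])
    qed
    ultimately have "(\<lambda>n. s (Q (b n)) - s (P (b n))) \<longlonglongrightarrow> 0" by simp
    moreover have "isCont s p" "isCont s q"
      using s holomorphic_on_imp_continuous_on continuous_on_eq_continuous_at open_UNIV by blast+
    hence "(\<lambda>n. s (Q (b n)) - s (P (b n))) \<longlonglongrightarrow> s q - s p"
      using lim by (intro tendsto_diff) (auto intro: isCont_tendsto_compose)
    ultimately show False using sne LIMSEQ_unique by fastforce
  qed
  hence "countable (\<phi> ` {z. W z = 0} \<union> C)" using N by blast
  moreover have "?B \<subseteq> \<phi> ` {z. W z = 0} \<union> C" unfolding C_def by blast
  ultimately show ?thesis by (rule countable_subset[rotated])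
qed

section \<open>Periodic functions on a half plane\<close>

lemma periodic_int:
  assumes per: "\<And>z. Im z > Y \<Longrightarrow> q (z + of_real p) = q z" and "Im z > Y"
  shows "q (z + of_int k * of_real p) = q z"
proof -
  have nat: "q (z + of_nat n * of_real p) = q z" if "Im z > Y" for n z
  proof (induction n)
    case (Suc n)
    have "q (z + of_nat n * of_real p + of_real p) = q (z + of_nat n * of_real p)"
      using that by (intro per) auto
    thus ?case using Suc by (simp add: algebra_simps)
  qed auto
  show ?thesis
  proof (cases "k \<ge> 0")
    case True
    thus ?thesis using nat[OF assms(2), of "nat k"] by simp
  next
    case False
    have "q (z + of_int k * of_real p + of_nat (nat (-k)) * of_real p) = q (z + of_int k * of_real p)"
      using assms(2) by (intro nat) auto
    thus ?thesis using False by simp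
  qed
qed

lemma periodic_halfplane_quotient:
  fixes q :: "complex \<Rightarrow> complex"
  assumes hol: "q holomorphic_on {z. Im z > Y}"
    and per: "\<And>z. Im z > Y \<Longrightarrow> q (z + of_real p) = q z" and p: "p > 0"
  obtains G where "G holomorphic_on ball 0 (exp (-2*pi*Y/p)) - {0}"
    "\<And>z. Im z > Y \<Longrightarrow> q z = G (exp (2*pi*\<i>*z/p))"
proof
  define c :: complex where "c = of_real p / (2*pi*\<i>)"
  \<comment> \<open>The principal logarithm jumps by \<open>2 pi i\<close> across its cut, which
    moves \<open>c * Ln u\<close> by exactly the period \<open>p\<close>, so \<open>G\<close> does
    not see the cut.\<close>
  define G where "G u = q (c * Ln u)" for u
  have c0: "c \<noteq> 0" using p by (simp add: c_def)
  have Im_c: "Im (c * w) = - p * Re w / (2*pi)" for w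
    by (simp add: c_def Im_divide power2_eq_square)
  have cexp: "2*pi*\<i>*(c*w)/p = w" for w
    using p by (simp add: c_def)
  have cc: "c * (2*pi*\<i>*z/p) = z" for z
    using p by (simp add: c_def)
  have Gq: "G (exp w) = q (c * w)" if "Im (c * w) > Y" for w
  proof -
    obtain k where k: "Ln (exp w) = w + of_int k * (2*pi*\<i>)"
    proof -
      have "exp (Ln (exp w)) = exp w" by simp
      hence "\<exists>n::int. Ln (exp w) = w + of_int (2*n) * pi * \<i>"
        unfolding exp_eq by simp
      thus ?thesis using that by (auto simp: algebra_simps)
    qed
    have "c * Ln (exp w) = c * w + of_int k * of_real p"
      unfolding k by (simp add: c_def algebra_simps)
    thus ?thesis unfolding G_def
      using periodic_int[of Y q p "c*w" k] per that by simp
  qed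
  show "q z = G (exp (2*pi*\<i>*z/p))" if "Im z > Y" for z
    using Gq[of "2*pi*\<i>*z/p"] that by (simp only: cc)
  show "G holomorphic_on ball 0 (exp (-2*pi*Y/p)) - {0}"
  proof -
    have "G field_differentiable at u" if u: "norm u < exp (-2*pi*Y/p)" "u \<noteq> 0" for u
    proof -
      \<comment> \<open>This branch of the logarithm is centred at \<open>u\<close>, hence
        holomorphic near \<open>u\<close> even if \<open>u\<close> lies on the cut;
        \<open>Gq\<close> identifies \<open>H\<close> with \<open>G\<close>.\<close>
      define H where "H v = q (c * (Ln (v/u) + Ln u))" for v
      have dom: "open ({v. Re (v/u) > 0 \<and> v \<noteq> 0 \<and> norm v < exp (-2*pi*Y/p)})" (is "open ?D")
        using u by (intro open_Collect_conj open_Collect_less open_Collect_neq continuous_intros) auto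
      have uD: "u \<in> ?D" using u by simp
      have ImY: "Im (c * w) > Y" if "norm (exp w) < exp (-2*pi*Y/p)" for w
      proof -
        have "Re w < -2*pi*Y/p" using that by simp
        hence "p * Re w < -2*pi*Y" using p by (simp add: field_simps)
        hence "-p * Re w / (2*pi) > Y" by (simp add: field_simps)
        thus ?thesis by (simp only: Im_c)
      qed
      have eq: "G v = H v" and Imv: "Im (c * (Ln (v/u) + Ln u)) > Y" if v: "v \<in> ?D" for v
      proof -
        have e: "exp (Ln (v/u) + Ln u) = v" using v u by (simp add: exp_add)
        show "Im (c * (Ln (v/u) + Ln u)) > Y" by (rule ImY) (use v e in auto)
        from Gq[OF this] show "G v = H v" unfolding e H_def .
      qed
      have "H holomorphic_on ?D"
        unfolding H_def
      proof (rule holomorphic_on_compose_gen[of _ _ q "{z. Im z > Y}", unfolded o_def])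
        show "(\<lambda>v. c * (Ln (v/u) + Ln u)) holomorphic_on ?D"
          using u by (intro holomorphic_intros) (auto simp: complex_nonpos_Reals_iff)
      qed (use hol Imv in auto)
      hence "(H has_field_derivative deriv H u) (at u)"
        using dom uD holomorphic_derivI by blast
      hence "(G has_field_derivative deriv H u) (at u)"
        by (rule has_field_derivative_transform_within_open[OF _ dom uD]) (use eq in auto)
      thus ?thesis using field_differentiable_def by blast
    qed
    thus ?thesis
      by (auto simp: holomorphic_on_def intro: field_differentiable_at_within)
  qed
qed

text \<open>An upper half plane corresponds to a punctured disc around the origin under
  \<open>u = exp (2 \<pi> i z / p)\<close>, where the great Picard theorem applies.\<close>
lemma periodic_halfplane_Picard:
  fixes q :: "complex \<Rightarrow> complex"
  assumes hol: "q holomorphic_on {z. Im z > Y}"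
    and per: "\<And>z. Im z > Y \<Longrightarrow> q (z + of_real p) = q z" and p: "p > 0"
    and omit: "a \<noteq> b" "\<And>z. Im z > Y \<Longrightarrow> q z \<noteq> a \<and> q z \<noteq> b"
  shows "(\<exists>B Y1. \<forall>z. Im z > Y1 \<longrightarrow> norm (q z) \<le> B) \<or>
    ((\<exists>B Y1 N. \<forall>z. Im z > Y1 \<longrightarrow> norm (q z) \<le> B * exp (real N * Im z)) \<and>
     (\<forall>Y'. \<exists>W. \<forall>w. norm w > W \<longrightarrow> (\<exists>z. Im z > Y' \<and> q z = w)) \<and>
     (\<forall>W. \<exists>Y1. \<forall>z. Im z > Y1 \<longrightarrow> norm (q z) > W) \<and>
     (\<exists>Y1. \<forall>z. Im z > Y1 \<longrightarrow> deriv q z \<noteq> 0))"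
proof -
  define r where "r = exp (-2*pi*Y/p)"
  obtain G where G: "G holomorphic_on ball 0 r - {0}" 
    and qG: "\<And>z. Im z > Y \<Longrightarrow> q z = G (exp (2*pi*\<i>*z/p))"
    using periodic_halfplane_quotient[OF hol per p] unfolding r_def by metis
  have r0: "r > 0" by (simp add: r_def)
  define e where "e z = exp (2*pi*\<i>*z/p)" for z :: complex
  have ne: "norm (e z) = exp (-2*pi*Im z/p)" for z
    by (simp add: e_def)
  have ene: "e z \<noteq> 0" for z by (simp add: e_def)
  have lev: "\<exists>Y1\<ge>Y. \<forall>z. Im z > Y1 \<longrightarrow> norm (e z) < d" if "d > 0" for d
  proof (intro exI[of _ "max Y (- p * ln d / (2*pi))"] conjI allI impI)
    fix z assume "Im z > max Y (- p * ln d / (2*pi))"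
    hence "- p * ln d < 2*pi * Im z" by (simp add: field_simps)
    hence "-2*pi*Im z / p < ln d" using p by (simp add: field_simps)
    thus "norm (e z) < d" unfolding ne using that by (metis exp_less_mono exp_ln)
  qed auto
  have surj: "\<exists>z. Im z > Y' \<and> e z = u" if "u \<noteq> 0" "norm u < exp (-2*pi*Y'/p)" for u Y'
  proof (intro exI[of _ "p * Ln u / (2*pi*\<i>)"] conjI)
    show eu: "e (p * Ln u / (2*pi*\<i>)) = u" using that p by (simp add: e_def)
    have "exp (-2*pi*Im (p * Ln u / (2*pi*\<i>))/p) < exp (-2*pi*Y'/p)"
      using that(2) unfolding ne[symmetric] eu .
    thus "Im (p * Ln u / (2*pi*\<i>)) > Y'"
      using p by (simp add: divide_less_cancel)
  qed
  have qe: "q z = G (e z)" if "Im z > Y" for z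
    using qG that by (simp add: e_def)
  have Gomit: "G u \<noteq> a \<and> G u \<noteq> b" if "u \<in> ball 0 r - {0}" for u
    using surj[of u Y] qe omit(2) that by (metis DiffD1 DiffD2 insertI1 mem_ball_0 r_def)
  \<comment> \<open>After the shift \<open>D\<close> has no zeros, so its reciprocal is holomorphic
    on the punctured disc and can stand in for \<open>D\<close> in the case of a pole.\<close>
  define D where "D u = G u - a" for u
  have holD: "D holomorphic_on ball 0 r - {0}"
    unfolding D_def by (intro holomorphic_intros G)
  have Dne: "D u \<noteq> 0" if "u \<in> ball 0 r - {0}" for u
    using Gomit[OF that] by (simp add: D_def)
  have "0 \<noteq> b - a" "\<And>u. u \<in> ball 0 r - {0} \<Longrightarrow> D u \<noteq> 0 \<and> D u \<noteq> b - a"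
    using omit(1) Gomit by (auto simp: D_def)
  then obtain l where "(D \<longlongrightarrow> l) (at 0) \<or> ((inverse \<circ> D) \<longlongrightarrow> l) (at 0)"
    using great_Picard[OF open_ball _ _ holD, of 0 "b - a"] r0 by auto
  then consider l where "(D \<longlongrightarrow> l) (at 0)" | "((\<lambda>u. inverse (D u)) \<longlongrightarrow> 0) (at 0)"
  proof
    assume *: "((inverse \<circ> D) \<longlongrightarrow> l) (at 0)"
    show thesis
    proof (cases "l = 0")
      case False
      from tendsto_inverse[OF * this] have "(D \<longlongrightarrow> inverse l) (at 0)" by simp
      thus ?thesis using that by blast
    qed (use * that in \<open>simp add: o_def\<close>)
  qed blast
  thus ?thesis
  proof cases
    case 1
    hence "((\<lambda>u. norm (D u)) \<longlongrightarrow> norm l) (at 0)" by (rule tendsto_norm)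
    hence "eventually (\<lambda>u. norm (D u) < norm l + 1) (at 0)"
      by (rule order_tendstoD) simp
    then obtain d where d: "d > 0" "\<And>u. u \<noteq> 0 \<Longrightarrow> norm u < d \<Longrightarrow> norm (D u) < norm l + 1"
      by (auto simp: eventually_at dist_norm)
    obtain Y1 where Y1: "Y1 \<ge> Y" "\<And>z. Im z > Y1 \<Longrightarrow> norm (e z) < d" using lev[OF d(1)] by blast
    have "norm (q z) \<le> norm l + 1 + norm a" if "Im z > Y1" for z
    proof -
      have "norm (D (e z)) < norm l + 1" using Y1 that ene d(2) by blast
      thus ?thesis using qe[of z] Y1(1) that norm_triangle_sub[of "G (e z)" a] by (simp add: D_def)
    qed
    thus ?thesis by blast
  next
    case 2
    \<comment> \<open>In the pole case the reciprocal extends across the origin by 0, and every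
      remaining claim about \<open>q\<close> becomes a local claim about the zero of
      \<open>H\<close> there.\<close>
    define H where "H u = (if u = 0 then 0 else inverse (D u))" for u
    have H0: "H 0 = 0" by (simp add: H_def)
    have Hne: "H u \<noteq> 0" if "u \<in> ball 0 r - {0}" for u
      using Dne that by (auto simp: H_def)
    have holH: "H holomorphic_on ball 0 r"
    proof (rule no_isolated_singularity'[of "{0}"])
      have "(\<lambda>u. inverse (D u)) holomorphic_on ball 0 r - {0}"
        by (intro holomorphic_intros holD Dne)
      thus "H holomorphic_on ball 0 r - {0}"
        by (rule holomorphic_transform) (auto simp: H_def)
      show "(H \<longlongrightarrow> H z) (at z within ball 0 r)" if "z \<in> {0}" for z
      proof -
        have "(H \<longlongrightarrow> 0) (at 0)"
          using 2 by (rule Lim_transform_eventually) (auto simp: H_def eventually_at_filter)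
        thus ?thesis using that by (auto simp: H_def intro: tendsto_within_subset)
      qed
    qed auto
    have qH: "q z = a + inverse (H (e z))" "H (e z) \<noteq> 0" if "Im z > Y" for z
    proof -
      have "e z \<in> ball 0 r - {0}"
        using that p by (simp add: ne ene r_def divide_strict_right_mono)
      thus "q z = a + inverse (H (e z))" "H (e z) \<noteq> 0"
        using Hne ene[of z] by (auto simp: H_def D_def qe[OF that])
    qed
    have ncH: "\<not> H constant_on ball 0 r"
    proof
      assume "H constant_on ball 0 r"
      hence "H (of_real (r/2)) = H 0" using r0 unfolding constant_on_def by force
      thus False using Hne[of "of_real (r/2)"] r0 H0 by auto
    qed
    have "\<forall>Y'. \<exists>W. \<forall>w. norm w > W \<longrightarrow> (\<exists>z. Im z > Y' \<and> q z = w)"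
    proof
      fix Y'
      define s where "s = min r (exp (-2*pi*Y'/p))"
      have s0: "s > 0" "s \<le> r" by (auto simp: s_def r0)
      \<comment> \<open>\<open>H\<close> covers a disc around 0 by the open mapping theorem, hence
        \<open>q = a + 1 / H\<close> covers the exterior of a disc.\<close>
      have "open (H ` ball 0 s)"
        using open_mapping_thm[OF holH _ _ _ _ ncH, of "ball 0 s"] s0 by (auto simp: subset_ball)
      moreover have "0 \<in> H ` ball 0 s" using H0 s0 by force
      ultimately obtain \<epsilon> where \<epsilon>: "\<epsilon> > 0" "ball 0 \<epsilon> \<subseteq> H ` ball 0 s"
        using openE by blast
      have "\<exists>z. Im z > Y' \<and> q z = w" if "norm w > norm a + 1/\<epsilon>" for w
      proof -
        have "norm (w - a) > 1/\<epsilon>" using that norm_triangle_ineq2[of w a] by simp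
        hence nz: "w - a \<noteq> 0" using \<epsilon>(1) by (metis less_asym norm_zero zero_less_divide_1_iff)
        have "norm (inverse (w - a)) < \<epsilon>"
          using \<open>norm (w - a) > 1/\<epsilon>\<close> \<epsilon>(1) nz by (simp add: norm_inverse norm_divide field_simps)
        then obtain u where u: "u \<in> ball 0 s" "H u = inverse (w - a)" using \<epsilon>(2) by force
        have "u \<noteq> 0" using u nz H0 by auto
        moreover have "norm u < exp (-2*pi*(max Y Y')/p)"
          using u(1) by (cases "Y \<le> Y'") (auto simp: s_def r_def max_def)
        ultimately obtain z where z: "Im z > max Y Y'" "e z = u"
          using surj by blast
        thus ?thesis using qH[of z] u(2) by auto
      qed
      thus "\<exists>W. \<forall>w. norm w > W \<longrightarrow> (\<exists>z. Im z > Y' \<and> q z = w)" by blast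
    qed
    moreover have "\<forall>W. \<exists>Y1. \<forall>z. Im z > Y1 \<longrightarrow> norm (q z) > W"
    proof
      fix W :: real
      define \<epsilon> where "\<epsilon> = 1 / (\<bar>W\<bar> + norm a + 1)"
      have e0: "\<epsilon> > 0" by (simp add: \<epsilon>_def add_nonneg_pos)
      have "eventually (\<lambda>u. norm (H u) < \<epsilon>) (at 0)"
      proof -
        have "(H \<longlongrightarrow> 0) (at 0)"
          using 2 by (rule Lim_transform_eventually) (auto simp: H_def eventually_at_filter)
        from tendsto_norm_zero[OF this] show ?thesis by (rule order_tendstoD) (rule e0)
      qed
      then obtain d where d: "d > 0" "\<And>u. u \<noteq> 0 \<Longrightarrow> norm u < d \<Longrightarrow> norm (H u) < \<epsilon>"
        by (auto simp: eventually_at dist_norm)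
      obtain Y1 where Y1: "Y1 \<ge> Y" "\<And>z. Im z > Y1 \<Longrightarrow> norm (e z) < d" using lev[OF d(1)] by blast
      have "norm (q z) > W" if "Im z > Y1" for z
      proof -
        have "norm (H (e z)) < \<epsilon>" "H (e z) \<noteq> 0" using d(2) Y1 that ene qH(2)[of z] by auto
        hence "norm (inverse (H (e z))) > 1/\<epsilon>" using e0 by (simp add: norm_inverse norm_divide field_simps)
        hence "norm (inverse (H (e z))) > \<bar>W\<bar> + norm a + 1" by (simp add: \<epsilon>_def)
        moreover have "norm (inverse (H (e z))) \<le> norm (q z) + norm a"
          using qH(1)[of z] Y1(1) that norm_triangle_ineq4[of "q z" a] by simp
        ultimately show ?thesis by linarith
      qed
      thus "\<exists>Y1. \<forall>z. Im z > Y1 \<longrightarrow> norm (q z) > W" by blast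
    qed
    moreover have "\<exists>Y1. \<forall>z. Im z > Y1 \<longrightarrow> deriv q z \<noteq> 0"
    proof -
      have holdH: "deriv H holomorphic_on ball 0 r" using holH by (intro holomorphic_deriv) auto
      have "\<exists>d>0. d \<le> r \<and> (\<forall>u\<in>ball 0 d - {0}. deriv H u \<noteq> 0)"
      proof (cases "deriv H 0 = 0")
        case False
        have "isCont (deriv H) 0" 
          using holomorphic_on_imp_continuous_on[OF holdH] r0
          by (simp add: continuous_on_eq_continuous_at)
        then obtain d where "d > 0" "\<forall>y. dist 0 y < d \<longrightarrow> deriv H y \<noteq> 0"
          using continuous_at_avoid[of 0 "deriv H" 0] False by blast
        thus ?thesis using r0 by (intro exI[of _ "min d r"]) auto
      next
        case True
        have "\<exists>\<beta>\<in>ball 0 r. deriv H \<beta> \<noteq> 0"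
        proof (rule ccontr)
          assume "\<not> ?thesis"
          hence "\<And>x. x \<in> ball 0 r \<Longrightarrow> (H has_field_derivative 0) (at x within ball 0 r)"
            using holH by (metis has_field_derivative_at_within holomorphic_derivI open_ball)
          hence "H constant_on ball 0 r"
            using has_field_derivative_zero_constant[of "ball 0 r" H] by (auto simp: constant_on_def)
          thus False using ncH by simp
        qed
        then obtain \<beta> where "\<beta> \<in> ball 0 r" "deriv H \<beta> \<noteq> 0" by blast
        from isolated_zeros[OF holdH open_ball connected_ball _ True this] r0
        obtain d where "d > 0" "ball 0 d \<subseteq> ball (0::complex) r" "\<And>z. z \<in> ball 0 d - {0} \<Longrightarrow> deriv H z \<noteq> 0"
          by auto
        moreover from this have "d \<le> r" using r0 by (simp add: ball_subset_ball_iff)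
        ultimately show ?thesis by blast
      qed
      then obtain d where d: "d > 0" "d \<le> r" "\<And>u. u \<in> ball 0 d - {0} \<Longrightarrow> deriv H u \<noteq> 0" by blast
      obtain Y1 where Y1: "Y1 \<ge> Y" "\<And>z. Im z > Y1 \<Longrightarrow> norm (e z) < d" using lev[OF d(1)] by blast
      have "deriv q z \<noteq> 0" if z: "Im z > Y1" for z
      proof -
        have zY: "Im z > Y" and ez: "e z \<in> ball 0 d - {0}" "e z \<in> ball 0 r" using Y1 z ene d(2) by force+
        have "(H has_field_derivative deriv H (e z)) (at (e z))"
          using holH ez(2) holomorphic_derivI by blast
        moreover have "(e has_field_derivative (2*pi*\<i>/p * e z)) (at z)"
          unfolding e_def using p by (auto intro!: derivative_eq_intros)
        ultimately have "((\<lambda>z. H (e z)) has_field_derivative deriv H (e z) * (2*pi*\<i>/p * e z)) (at z)"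
          using DERIV_chain2 by blast
        hence "((\<lambda>z. a + inverse (H (e z))) has_field_derivative 
            - (inverse (H (e z)) * (deriv H (e z) * (2*pi*\<i>/p * e z)) * inverse (H (e z)))) (at z)"
          using qH(2)[OF zY] by (auto intro!: derivative_eq_intros)
        hence "(q has_field_derivative - (inverse (H (e z)) * (deriv H (e z) * (2*pi*\<i>/p * e z)) * inverse (H (e z)))) (at z)"
          by (rule has_field_derivative_transform_within_open[of _ _ _ "{z. Im z > Y}"])
             (use zY qH(1) in \<open>auto simp: open_halfspace_Im_gt\<close>)
        hence "deriv q z = - (inverse (H (e z)) * (deriv H (e z) * (2*pi*\<i>/p * e z)) * inverse (H (e z)))"
          by (rule DERIV_imp_deriv)
        moreover have "p \<noteq> 0" using p by simp
        ultimately show ?thesis using qH(2)[OF zY] d(3)[OF ez(1)] ene[of z] by simp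
      qed
      thus ?thesis by blast
    qed
    moreover have "\<exists>B Y1 N. \<forall>z. Im z > Y1 \<longrightarrow> norm (q z) \<le> B * exp (real N * Im z)"
    proof -
      \<comment> \<open>The order \<open>n\<close> of the zero of \<open>H\<close> fixes the
        exponential rate, since \<open>norm (e z)\<close> decays like
        \<open>exp (- 2 pi Im z / p)\<close>.\<close>
      obtain g s n where s: "s > 0" "n > 0" "ball 0 s \<subseteq> ball (0::complex) r" "g holomorphic_on ball 0 s"
        "\<And>w. w \<in> ball 0 s \<Longrightarrow> H w - H 0 = (w - 0) ^ n * g w" "\<And>w. w \<in> ball 0 s \<Longrightarrow> g w \<noteq> 0"
        using holomorphic_factor_zero_nonconstant[OF holH open_ball connected_ball _ H0 ncH] r0
        by (metis H0 centre_in_ball diff_zero)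
      obtain c where c: "c > 0" "\<And>w. w \<in> cball 0 (s/2) \<Longrightarrow> c \<le> norm (g w)"
      proof -
        have "continuous_on (cball 0 (s/2)) (\<lambda>w. norm (g w))"
          using s(1,4) by (intro continuous_intros holomorphic_on_imp_continuous_on) (auto elim: holomorphic_on_subset)
        then obtain x where x: "x \<in> cball 0 (s/2)" "\<forall>y\<in>cball 0 (s/2). norm (g x) \<le> norm (g y)"
          using continuous_attains_inf[of "cball 0 (s/2)" "\<lambda>w. norm (g w)"] s(1) by auto
        show ?thesis by (rule that[of "norm (g x)"]) (use x s(1,6) in auto)
      qed
      obtain Y1 where Y1: "Y1 \<ge> Y" "\<And>z. Im z > Y1 \<Longrightarrow> norm (e z) < s/2" using lev[of "s/2"] s(1) by auto
      obtain N :: nat where N: "real N \<ge> 2*pi*n/p" using real_arch_simple by blast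
      have "norm (q z) \<le> (norm a + 1/c) * exp (real N * Im z)" if z: "Im z > max Y1 0" for z
      proof -
        have zY: "Im z > Y" using z Y1 by simp
        have es: "e z \<in> ball 0 s" "e z \<in> cball 0 (s/2)" using Y1(2)[of z] z s(1) by auto
        have "norm (H (e z)) = norm (e z) ^ n * norm (g (e z))"
          using s(5)[OF es(1)] H0 by (simp add: norm_mult norm_power)
        also have "\<dots> \<ge> norm (e z) ^ n * c" using c(2)[OF es(2)] by (intro mult_left_mono) auto
        finally have "norm (H (e z)) \<ge> norm (e z) ^ n * c" .
        hence "norm (inverse (H (e z))) \<le> inverse (norm (e z) ^ n * c)"
          unfolding norm_inverse using c(1) ene[of z] by (intro le_imp_inverse_le) auto
        also have "norm (e z) ^ n = inverse (exp (2*pi*n/p * Im z))"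
          unfolding ne exp_of_nat_mult[symmetric] exp_minus[symmetric] by (simp add: field_simps)
        also have "inverse (inverse (exp (2*pi*n/p * Im z)) * c) = 1/c * exp (2*pi*n/p * Im z)"
          by (simp add: field_simps)
        also have "\<dots> \<le> 1/c * exp (real N * Im z)"
          using c(1) mult_right_mono[OF N, of "Im z"] z by (intro mult_left_mono) auto
        finally have "norm (inverse (H (e z))) \<le> 1/c * exp (real N * Im z)" .
        moreover have "norm a * 1 \<le> norm a * exp (real N * Im z)"
          using z by (intro mult_left_mono) auto
        ultimately show ?thesis
          using qH(1)[OF zY] norm_triangle_ineq[of a "inverse (H (e z))"] by (simp add: algebra_simps)
      qed
      thus ?thesis by blast
    qed
    ultimately show ?thesis by blast
  qed
qed


corollary periodic_halfplane_Picard_growth: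
  fixes q :: "complex \<Rightarrow> complex"
  assumes "q holomorphic_on {z. Im z > Y}"
    and "\<And>z. Im z > Y \<Longrightarrow> q (z + of_real p) = q z" and "p > 0"
    and "a \<noteq> b" "\<And>z. Im z > Y \<Longrightarrow> q z \<noteq> a \<and> q z \<noteq> b"
  shows "\<exists>B Y1 N. \<forall>z. Im z > Y1 \<longrightarrow> norm (q z) \<le> B * exp (real N * Im z)"
proof (rule periodic_halfplane_Picard[of q Y p a b, THEN disjE])
  assume "\<exists>B Y1. \<forall>z. Im z > Y1 \<longrightarrow> norm (q z) \<le> B"
  then obtain B Y1 where "\<forall>z. Im z > Y1 \<longrightarrow> norm (q z) \<le> B" by blast
  thus ?thesis by (intro exI[of _ B] exI[of _ Y1] exI[of _ 0]) simp
qed (use assms in simp_all)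

section \<open>The functions \<open>cos z * h (sin z) + a * sin z\<close>\<close>

lemma exp_gt_self: "exp x > (x :: real)"
  using exp_ge_add_one_self[of x] by linarith

text \<open>From height 1 on, \<open>exp (i z)\<close> has at most half the modulus of
  \<open>exp (- i z)\<close>; the factor 1/2 in sine and cosine turns the remaining half into a
  quarter.\<close>

lemma exp_le_norm_sin_cos:
  assumes "Im z \<ge> 1"
  shows "exp (Im z) \<le> 4 * norm (sin z)" "exp (Im z) \<le> 4 * norm (cos z)"
proof -
  have "exp (Im z) \<ge> 1 + 1" using exp_ge_add_one_self[of "Im z"] assms by linarith
  hence "exp (-Im z) \<le> 1/2" by (simp add: exp_minus field_simps)
  hence e: "exp (-Im z) \<le> exp (Im z) / 2" using \<open>exp (Im z) \<ge> 1 + 1\<close> by linarith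
  have n: "norm (exp (\<i>*z)) = exp (-Im z)" "norm (exp (-(\<i>*z))) = exp (Im z)" by simp_all
  have "norm (sin z) = norm (exp (-(\<i>*z)) - exp (\<i>*z)) / 2"
    by (simp add: sin_exp_eq norm_divide norm_mult norm_minus_commute)
  moreover have "norm (exp (-(\<i>*z)) - exp (\<i>*z)) \<ge> exp (Im z) - exp (-Im z)"
    using norm_triangle_ineq2[of "exp (-(\<i>*z))" "exp (\<i>*z)"] n by simp
  ultimately show "exp (Im z) \<le> 4 * norm (sin z)" using e by linarith
  have "norm (cos z) = norm (exp (-(\<i>*z)) + exp (\<i>*z)) / 2"
    by (simp add: cos_exp_eq norm_divide add.commute)
  moreover have "norm (exp (-(\<i>*z)) + exp (\<i>*z)) \<ge> exp (Im z) - exp (-Im z)"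
    using norm_diff_ineq[of "exp (-(\<i>*z))" "exp (\<i>*z)"] n by simp
  ultimately show "exp (Im z) \<le> 4 * norm (cos z)" using e by linarith
qed

lemma norm_sin_cos_le_exp:
  assumes "Im z \<ge> 0"
  shows "norm (sin z) \<le> exp (Im z)" "norm (cos z) \<le> exp (Im z)"
proof -
  have e: "exp (-Im z) \<le> exp (Im z)" using assms by simp
  have n: "norm (exp (\<i>*z)) = exp (-Im z)" "norm (exp (-(\<i>*z))) = exp (Im z)" by simp_all
  have "norm (sin z) = norm (exp (\<i>*z) - exp (-(\<i>*z))) / 2"
    by (simp add: sin_exp_eq norm_divide norm_mult)
  thus "norm (sin z) \<le> exp (Im z)" 
    using e norm_triangle_ineq4[of "exp (\<i>*z)" "exp (-(\<i>*z))"] n by linarith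
  have "norm (cos z) = norm (exp (\<i>*z) + exp (-(\<i>*z))) / 2"
    by (simp add: cos_exp_eq norm_divide)
  thus "norm (cos z) \<le> exp (Im z)" 
    using e norm_triangle_ineq[of "exp (\<i>*z)" "exp (-(\<i>*z))"] n by linarith
qed

lemma polynomial_growth_imp_poly:
  assumes "f holomorphic_on UNIV" "\<And>z. A \<le> norm z \<Longrightarrow> norm (f z) \<le> B * norm z ^ n"
  obtains p :: "complex poly" where "\<And>z. f z = poly p z" "degree p \<le> n"
proof
  define p where "p = (\<Sum>k\<le>n. monom ((deriv ^^ k) f 0 / fact k) k)"
  show "f z = poly p z" for z
    unfolding p_def poly_sum poly_monom by (rule Liouville_polynomial[OF assms])
  show "degree p \<le> n"
    unfolding p_def by (intro degree_sum_le) (auto intro: order_trans[OF degree_monom_le])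
qed

text \<open>Every \<open>w\<close> of large modulus is \<open>sin z\<close> with \<open>z\<close>
  high up, where \<open>exp (Im z)\<close> is comparable to \<open>norm w\<close>. Exponential
  growth in \<open>Im z\<close> is therefore polynomial growth in \<open>w\<close>; the cosine, of
  modulus at least 1 there, can be divided out.\<close>

lemma sin_composite_growth_imp_poly:
  assumes h: "h holomorphic_on UNIV"
    and bd: "\<And>z. Im z > Y \<Longrightarrow> norm (cos z * h (sin z) + a * sin z) \<le> B * exp (real N * Im z)"
  shows "\<exists>p :: complex poly. \<forall>z. h z = poly p z"
proof -
  define Y0 where "Y0 = max Y 1"
  define A where "A = exp (Y0 + 1)"
  have "norm (h w) \<le> (\<bar>B\<bar> * 4^N + norm a) * norm w ^ (N + 1)" if w: "A \<le> norm w" for w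
  proof -
    \<comment> \<open>The two preimages have the same sine and opposite imaginary parts, so one of
      them lies in the closed upper half plane.\<close>
    have "Im (Arcsin w) \<ge> 0 \<or> Im (of_real pi - Arcsin w) \<ge> 0" by auto
    moreover have "sin (Arcsin w) = w" "sin (of_real pi - Arcsin w) = w" by (simp_all add: sin_diff)
    ultimately obtain z where z: "sin z = w" "Im z \<ge> 0" by metis
    have "exp (Y0 + 1) \<le> exp (Im z)" using norm_sin_cos_le_exp(1)[OF z(2)] w unfolding z(1) A_def by linarith
    hence Im: "Im z > Y0" by simp
    hence y1: "Im z \<ge> 1" and y2: "Im z > Y" by (auto simp: Y0_def)
    have "1 \<le> A" by (simp add: A_def Y0_def)
    hence w1: "1 \<le> norm w" using w by simp
    have c: "norm (cos z) \<ge> 1"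
    proof -
      have "exp (Im z) \<ge> exp 2" using Im \<open>exp (Y0 + 1) \<le> exp (Im z)\<close> by (simp add: Y0_def)
      moreover have "exp (2::real) \<ge> 4"
      proof -
        have "exp (1::real) \<ge> 2" using exp_ge_add_one_self[of 1] by simp
        hence "exp (1::real) * exp 1 \<ge> 2 * 2" by (intro mult_mono) auto
        thus ?thesis by (simp add: exp_add[symmetric])
      qed
      ultimately show ?thesis using exp_le_norm_sin_cos(2)[OF y1] by linarith
    qed
    have "exp (real N * Im z) = exp (Im z) ^ N" by (simp add: exp_of_nat_mult)
    also have "\<dots> \<le> (4 * norm w) ^ N" using exp_le_norm_sin_cos(1)[OF y1] z(1) by (intro power_mono) auto
    finally have e: "exp (real N * Im z) \<le> 4^N * norm w ^ N" by (simp add: power_mult_distrib)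
    have wN: "norm w ^ N \<le> norm w ^ (N+1)" "norm w \<le> norm w ^ (N+1)"
      using power_increasing[of N "N+1" "norm w"] self_le_power[of "norm w" "N+1"] w1 by simp_all
    have "norm (h w) \<le> norm (cos z) * norm (h w)" using c mult_right_mono[of 1 "norm (cos z)" "norm (h w)"] by simp
    also have "\<dots> = norm ((cos z * h (sin z) + a * sin z) - a * w)" by (simp add: z(1) norm_mult)
    also have "\<dots> \<le> B * exp (real N * Im z) + norm a * norm w"
      using bd[OF y2] norm_triangle_ineq4[of "cos z * h (sin z) + a * sin z" "a * w"] by (simp add: norm_mult)
    also have "\<dots> \<le> \<bar>B\<bar> * (4^N * norm w ^ (N+1)) + norm a * norm w ^ (N+1)"
    proof (intro add_mono mult_mono)
      show "exp (real N * Im z) \<le> 4 ^ N * norm w ^ (N + 1)"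
        by (rule order_trans[OF e]) (intro mult_left_mono wN(1), simp)
    qed (use wN in auto)
    finally show ?thesis by (simp add: algebra_simps)
  qed
  from polynomial_growth_imp_poly[OF h this] show ?thesis by metis
qed

section \<open>Reflection identity, values and critical points of \<open>F\<close>\<close>

locale sin_composite =
  fixes h :: "complex \<Rightarrow> complex" and a :: complex
  assumes transcendental: "transcendental_entire h" and a_nonzero: "a \<noteq> 0"
begin

definition F :: "complex \<Rightarrow> complex" where "F z = cos z * h (sin z) + a * sin z"

lemma holomorphic_h: "h holomorphic_on A"
  using transcendental holomorphic_on_subset unfolding transcendental_entire_def entire_def by blast

lemma holomorphic_F: "F holomorphic_on A"
proof -
  have "(\<lambda>z. h (sin z)) holomorphic_on UNIV"
    using holomorphic_on_compose[of sin UNIV h] holomorphic_h by (simp add: o_def holomorphic_on_sin)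
  hence "F holomorphic_on UNIV" unfolding F_def by (intro holomorphic_intros) auto
  thus ?thesis using holomorphic_on_subset by blast
qed

lemma F_periodic: "F (z + 2 * of_real pi) = F z"
  by (simp add: F_def sin_add cos_add)

lemma F_periodic_int: "F (z + of_int k * (2 * of_real pi)) = F z"
  using periodic_int[of "Im z - 1" F "2*pi" z k] F_periodic by simp

lemma deriv_F_periodic_int: "deriv F (z + of_int k * (2 * of_real pi)) = deriv F z"
proof -
  have "((\<lambda>w. F (w + of_int k * (2 * of_real pi))) has_field_derivative deriv F (z + of_int k * (2 * of_real pi)) * 1) (at z)"
    by (rule DERIV_chain2[where g = "\<lambda>w. w + of_int k * (2 * of_real pi)"])
       (auto intro!: derivative_eq_intros holomorphic_derivI[OF holomorphic_F open_UNIV])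
  thus ?thesis by (simp add: F_periodic_int DERIV_imp_deriv)
qed

lemma F_reflect: "F z + F (of_real pi - z) = 2 * a * sin z"
  by (simp add: F_def sin_diff cos_diff)

lemma deriv_F_reflect: "deriv F z - deriv F (of_real pi - z) = 2 * a * cos z"
proof -
  have "((\<lambda>w. F w + F (of_real pi - w)) has_field_derivative deriv F z + deriv F (of_real pi - z) * (-1)) (at z)"
    by (rule DERIV_add[OF _ DERIV_chain2[where g = "\<lambda>w. of_real pi - w"]])
       (auto intro!: derivative_eq_intros holomorphic_derivI[OF holomorphic_F open_UNIV])
  moreover have "((\<lambda>w. F w + F (of_real pi - w)) has_field_derivative 2 * a * cos z) (at z)"
    unfolding F_reflect by (auto intro!: derivative_eq_intros)
  ultimately show ?thesis using DERIV_unique by fastforce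
qed

text \<open>The form in which the growth arguments use that \<open>h\<close> is not a
  polynomial.\<close>

lemma not_exp_bounded_upper:
  assumes "\<And>z. Im z > Y \<Longrightarrow> norm (F z) \<le> B * exp (real N * Im z)"
  shows False
  using sin_composite_growth_imp_poly[OF holomorphic_h, of Y a B N] assms transcendental
  by (auto simp: F_def transcendental_entire_def)

lemma not_exp_bounded_lower:
  assumes "\<And>z. Im z < - Y \<Longrightarrow> norm (F z) \<le> B * exp (- real N * Im z)"
  shows False
proof -
  \<comment> \<open>The reflection \<open>z \<mapsto> \<pi> - z\<close> interchanges the half planes
    and turns \<open>h\<close> into \<open>- h\<close>.\<close>
  have "\<exists>p :: complex poly. \<forall>z. - h z = poly p z"
  proof (rule sin_composite_growth_imp_poly)
    show "(\<lambda>z. - h z) holomorphic_on UNIV" by (intro holomorphic_intros holomorphic_h)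
    show "norm (cos z * - h (sin z) + a * sin z) \<le> B * exp (real N * Im z)" if "Im z > Y" for z
      using assms[of "of_real pi - z"] that by (simp add: F_def sin_diff cos_diff)
  qed
  then obtain p :: "complex poly" where "\<forall>z. - h z = poly p z" by blast
  hence "\<forall>z. h z = poly (-p) z" by (metis minus_minus poly_minus)
  thus False using transcendental unfolding transcendental_entire_def by blast
qed

text \<open>Integrating \<open>F'\<close> from a fixed point costs only the length of the path.
  Periodicity keeps the real part bounded, so this length is at most linear in \<open>Im z\<close>
  and is absorbed by raising \<open>N\<close> by one.\<close>

lemma deriv_not_exp_bounded_upper:
  assumes bd: "\<And>z. Im z > Y \<Longrightarrow> norm (deriv F z) \<le> B * exp (real N * Im z)"
  shows False
proof -
  define Y1 where "Y1 = max Y 0 + 1"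
  have "norm (F z) \<le> (norm (F (\<i> * Y1)) + 8 * \<bar>B\<bar>) * exp (real (N + 1) * Im z)" if z: "Im z > Y1" for z
  proof -
    define k where "k = \<lfloor>Re z / (2*pi)\<rfloor>"
    define z' where "z' = z + of_int (-k) * (2 * of_real pi)"
    have y: "Im z' = Im z" by (simp add: z'_def)
    have "0 \<le> Re z - k * (2*pi)" "Re z - k * (2*pi) \<le> 2*pi"
      using floor_divide_lower[of "2*pi" "Re z"] floor_divide_upper[of "2*pi" "Re z"] by (auto simp: k_def algebra_simps)
    hence Re: "\<bar>Re z'\<bar> \<le> 2*pi" by (simp add: z'_def)
    define S where "S = {w. Im w \<ge> Y1} \<inter> {w. Im w \<le> Im z}"
    have "convex S" unfolding S_def by (intro convex_Int convex_halfspace_Im_ge convex_halfspace_Im_le)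
    moreover have "norm (deriv F w) \<le> \<bar>B\<bar> * exp (real N * Im z)" if "w \<in> S" for w
    proof -
      have "norm (deriv F w) \<le> B * exp (real N * Im w)" using that by (intro bd) (auto simp: S_def Y1_def)
      also have "\<dots> \<le> \<bar>B\<bar> * exp (real N * Im z)"
        using that by (intro mult_mono) (auto simp: S_def intro!: mult_left_mono)
      finally show ?thesis .
    qed
    moreover have "(F has_field_derivative deriv F w) (at w within S)" for w
      by (rule has_field_derivative_at_within, rule holomorphic_derivI[OF holomorphic_F open_UNIV]) simp
    moreover have "z' \<in> S" "\<i> * Y1 \<in> S" using z y by (simp_all add: S_def)
    ultimately have b: "norm (F z' - F (\<i> * Y1)) \<le> \<bar>B\<bar> * exp (real N * Im z) * norm (z' - \<i> * Y1)"
      by (intro field_differentiable_bound[of S F "deriv F"])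
    have "norm (z' - \<i> * Y1) \<le> \<bar>Re z'\<bar> + \<bar>Im z' - Y1\<bar>"
      using cmod_le[of "z' - \<i> * Y1"] by simp
    moreover have "Y1 \<ge> 1" by (simp add: Y1_def)
    ultimately have "norm (z' - \<i> * Y1) \<le> 8 + 8 * Im z" using Re y z pi_less_4 by linarith
    also have "\<dots> \<le> 8 * exp (Im z)" using exp_ge_add_one_self[of "Im z"] by linarith
    finally have "norm (z' - \<i> * Y1) \<le> 8 * exp (Im z)" .
    hence "norm (F z' - F (\<i> * Y1)) \<le> \<bar>B\<bar> * exp (real N * Im z) * (8 * exp (Im z))"
      by (intro order_trans[OF b] mult_left_mono) simp_all
    also have "\<dots> = 8 * \<bar>B\<bar> * exp (real (N + 1) * Im z)"
      by (simp add: exp_add algebra_simps)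
    finally have "norm (F z' - F (\<i> * Y1)) \<le> 8 * \<bar>B\<bar> * exp (real (N + 1) * Im z)" .
    moreover have "F z' = F z" unfolding z'_def by (rule F_periodic_int)
    moreover have "norm (F (\<i> * Y1)) * 1 \<le> norm (F (\<i> * Y1)) * exp (real (N + 1) * Im z)"
      using z by (intro mult_left_mono) (auto simp: Y1_def)
    ultimately show ?thesis
      using norm_triangle_sub[of "F z" "F (\<i> * Y1)"] by (simp add: algebra_simps)
  qed
  thus False by (rule not_exp_bounded_upper)
qed

text \<open>\<open>D / C\<close> omits the values 0 and 1 as soon as neither \<open>D\<close> nor its reflection has zeros.\<close>
lemma reflected_zero_free_imp_exp_bounded:
  assumes hol: "D holomorphic_on UNIV" "C holomorphic_on UNIV"
    and per: "\<And>z. D (z + 2 * of_real pi) = D z" "\<And>z. C (z + 2 * of_real pi) = C z"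
    and sum: "\<And>z. D z + E z = C z"
    and nz: "\<And>z. Im z > Y \<Longrightarrow> D z \<noteq> 0 \<and> E z \<noteq> 0 \<and> C z \<noteq> 0"
    and C: "\<And>z. Im z > Y \<Longrightarrow> norm (C z) \<le> c * exp (Im z)"
  obtains B Y1 N where "\<And>z. Im z > Y1 \<Longrightarrow> norm (D z) \<le> B * exp (real N * Im z)"
proof -
  define q where "q z = D z / C z" for z
  have "\<exists>B Y1 N. \<forall>z. Im z > Y1 \<longrightarrow> norm (q z) \<le> B * exp (real N * Im z)"
  proof -
    have "q holomorphic_on {z. Im z > Y}"
      unfolding q_def using nz by (intro holomorphic_on_divide holomorphic_on_subset[OF hol(1)] holomorphic_on_subset[OF hol(2)]) auto
    moreover have "q (z + of_real (2*pi)) = q z" for z by (simp add: q_def per)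
    moreover have "q z \<noteq> 0 \<and> q z \<noteq> 1" if "Im z > Y" for z
      using nz[OF that] sum[of z] by (auto simp: q_def)
    ultimately show ?thesis
      by (intro periodic_halfplane_Picard_growth[of q Y "2*pi" 0 1]) simp_all
  qed
  then obtain B Y1 N where B: "\<And>z. Im z > Y1 \<Longrightarrow> norm (q z) \<le> B * exp (real N * Im z)" by blast
  have "norm (D z) \<le> \<bar>B\<bar> * \<bar>c\<bar> * exp (real (N + 1) * Im z)" if z: "Im z > max Y Y1" for z
  proof -
    have "norm (D z) = norm (q z) * norm (C z)" using nz[of z] z by (simp add: q_def norm_divide)
    also have "\<dots> \<le> (\<bar>B\<bar> * exp (real N * Im z)) * (\<bar>c\<bar> * exp (Im z))"
    proof (intro mult_mono)
      show "norm (q z) \<le> \<bar>B\<bar> * exp (real N * Im z)"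
        using z by (intro order_trans[OF B]) (auto intro!: mult_right_mono)
      show "norm (C z) \<le> \<bar>c\<bar> * exp (Im z)"
        using z by (intro order_trans[OF C]) (auto intro!: mult_right_mono)
    qed auto
    also have "\<dots> = \<bar>B\<bar> * \<bar>c\<bar> * exp (real (N + 1) * Im z)"
      by (simp add: exp_add algebra_simps)
    finally show ?thesis .
  qed
  thus ?thesis using that by blast
qed

lemma F_attains_value: "\<exists>z. \<bar>Im z\<bar> > Y \<and> F z = c"
proof (rule ccontr)
  assume no: "\<not> ?thesis"
  \<comment> \<open>Above \<open>Y1\<close> the estimate \<open>norm (sin z) > Im z / 4\<close>
    forces \<open>a * sin z \<noteq> c\<close>, so the sum of \<open>F z - c\<close> and its
    reflection, \<open>2 * (a * sin z - c)\<close>, has no zeros there.\<close>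
  define Y1 where "Y1 = max (max Y 1) (4 * norm c / norm a)"
  obtain B Y2 N where B: "\<And>z. Im z > Y2 \<Longrightarrow> norm (F z - c) \<le> B * exp (real N * Im z)"
  proof (rule reflected_zero_free_imp_exp_bounded[of "\<lambda>z. F z - c" "\<lambda>z. 2 * a * sin z - 2 * c" "\<lambda>z. F (of_real pi - z) - c" Y1 "2 * norm a + 2 * norm c"])
    fix z assume z: "Im z > Y1"
    have e: "exp (Im z) \<ge> 1" "exp (Im z) \<le> 4 * norm (sin z)" "exp (Im z) > Im z"
      using exp_le_norm_sin_cos(1)[of z] exp_gt_self[of "Im z"] z by (auto simp: Y1_def)
    have "4 * norm c / norm a < 4 * norm (sin z)" using e z by (simp add: Y1_def)
    hence "norm c < norm (a * sin z)" using a_nonzero by (simp add: field_simps norm_mult)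
    hence "a * sin z \<noteq> c" by auto
    moreover have "F z \<noteq> c" "F (of_real pi - z) \<noteq> c"
      using no[simplified, rule_format, of z] no[simplified, rule_format, of "of_real pi - z"] z by (auto simp: Y1_def)
    ultimately show "F z - c \<noteq> 0 \<and> F (of_real pi - z) - c \<noteq> 0 \<and> 2 * a * sin z - 2 * c \<noteq> 0" 
      by (simp add: mult.assoc)
    have "norm (2 * a * sin z - 2 * c) \<le> 2 * norm a * norm (sin z) + 2 * norm c"
      using norm_triangle_ineq4[of "2 * a * sin z" "2 * c"] by (simp add: norm_mult)
    also have "\<dots> \<le> 2 * norm a * exp (Im z) + 2 * norm c * exp (Im z)"
      using norm_sin_cos_le_exp(1)[of z] z e(1) mult_left_mono[of 1 "exp (Im z)" "2 * norm c"]
      by (intro add_mono mult_left_mono) (auto simp: Y1_def)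
    finally show "norm (2 * a * sin z - 2 * c) \<le> (2 * norm a + 2 * norm c) * exp (Im z)"
      by (simp add: algebra_simps)
  next
    show "F z - c + (F (of_real pi - z) - c) = 2 * a * sin z - 2 * c" for z
      using F_reflect[of z] by (simp add: algebra_simps)
    show "2 * a * sin (z + 2 * of_real pi) - 2 * c = 2 * a * sin z - 2 * c" for z by (simp add: sin_add)
  qed (auto intro!: holomorphic_intros holomorphic_F simp: F_periodic)
  have "norm (F z) \<le> (B + norm c) * exp (real N * Im z)" if "Im z > max Y2 0" for z
  proof -
    have "norm c * 1 \<le> norm c * exp (real N * Im z)" using that by (intro mult_left_mono) auto
    thus ?thesis using B[of z] that norm_triangle_sub[of "F z" c] by (simp add: algebra_simps)
  qed
  thus False by (rule not_exp_bounded_upper)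
qed

lemma F_critical_points: "\<exists>z. \<bar>Im z\<bar> > Y \<and> deriv F z = 0"
proof (rule ccontr)
  assume no: "\<not> ?thesis"
  have hol': "deriv F holomorphic_on UNIV" using holomorphic_F by (intro holomorphic_deriv) auto
  obtain B Y2 N where B: "\<And>z. Im z > Y2 \<Longrightarrow> norm (deriv F z) \<le> B * exp (real N * Im z)"
  proof (rule reflected_zero_free_imp_exp_bounded[of "deriv F" "\<lambda>z. 2 * a * cos z" "\<lambda>z. - deriv F (of_real pi - z)" "max Y 1" "2 * norm a"])
    fix z assume z: "Im z > max Y 1"
    have "cos z \<noteq> 0" using exp_le_norm_sin_cos(2)[of z] z by auto
    moreover have "deriv F z \<noteq> 0" "deriv F (of_real pi - z) \<noteq> 0"
      using no[simplified, rule_format, of z] no[simplified, rule_format, of "of_real pi - z"] z by auto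
    ultimately show "deriv F z \<noteq> 0 \<and> - deriv F (of_real pi - z) \<noteq> 0 \<and> 2 * a * cos z \<noteq> 0" using a_nonzero by simp
    show "norm (2 * a * cos z) \<le> 2 * norm a * exp (Im z)"
      using norm_sin_cos_le_exp(2)[of z] z by (auto simp: norm_mult intro!: mult_left_mono)
  next
    show "deriv F z + - deriv F (of_real pi - z) = 2 * a * cos z" for z using deriv_F_reflect[of z] by simp
    show "deriv F (z + 2 * of_real pi) = deriv F z" for z using deriv_F_periodic_int[of z 1] by simp
    show "2 * a * cos (z + 2 * of_real pi) = 2 * a * cos z" for z by (simp add: cos_add)
  qed (auto intro!: holomorphic_intros hol')
  thus False by (rule deriv_not_exp_bounded_upper)
qed

text \<open>Excludes the degenerate case in which the Wronskians of the later arguments vanish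
  identically.\<close>

lemma deriv_F_not_cos: "\<exists>z. deriv F z \<noteq> c * cos z"
proof (rule ccontr)
  assume no: "\<not> ?thesis"
  show False
  proof (rule deriv_not_exp_bounded_upper[of 0 "norm c" 1])
    fix z assume "Im z > 0"
    thus "norm (deriv F z) \<le> norm c * exp (real 1 * Im z)"
      using no norm_sin_cos_le_exp(2)[of z] by (auto simp: norm_mult mult_left_mono)
  qed
qed

end

section \<open>An identity between two exponentials\<close>

lemma holomorphic_factor_power:
  assumes V: "V holomorphic_on UNIV" and nz: "V z0 \<noteq> 0"
  obtains n W where "W holomorphic_on UNIV" "W c \<noteq> 0" "\<And>z. V z = (z - c) ^ n * W z"
proof (cases "V c = 0")
  case False
  show ?thesis by (rule that[of V 0]) (use V False in auto)
next
  case True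
  have "\<not> V constant_on UNIV" using nz True unfolding constant_on_def by force
  then obtain g s n where g: "s > 0" "g holomorphic_on ball c s"
    "\<And>w. w \<in> ball c s \<Longrightarrow> V w = (w - c) ^ n * g w" "\<And>w. w \<in> ball c s \<Longrightarrow> g w \<noteq> 0"
    using holomorphic_factor_zero_nonconstant[OF V open_UNIV connected_UNIV UNIV_I True] by metis
  define W where "W z = (if z = c then g c else V z / (z - c) ^ n)" for z
  have Wg: "W z = g z" if "z \<in> ball c s" for z
    using g(3)[OF that] by (auto simp: W_def)
  have "W holomorphic_on ball c s \<union> (UNIV - {c})"
  proof (rule holomorphic_on_Un)
    show "W holomorphic_on ball c s" by (rule holomorphic_transform[OF g(2)]) (simp add: Wg)
    have "(\<lambda>z. V z / (z - c) ^ n) holomorphic_on UNIV - {c}"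
      by (intro holomorphic_intros holomorphic_on_subset[OF V]) auto
    thus "W holomorphic_on UNIV - {c}" by (rule holomorphic_transform) (auto simp: W_def)
  qed auto
  moreover have "ball c s \<union> (UNIV - {c}) = UNIV" using g(1) by auto
  ultimately have "W holomorphic_on UNIV" by simp
  moreover have "W c \<noteq> 0" using g(1,4) by (auto simp: W_def)
  moreover have "V z = (z - c) ^ n * W z" for z
  proof (cases "z = c")
    case True thus ?thesis using g(1,3) by (auto simp: W_def)
  qed (auto simp: W_def)
  ultimately show ?thesis using that by blast
qed

text \<open>The Moebius map \<open>g / (2 * M - g)\<close> sends the half plane
  \<open>Re < M\<close> into the unit disc and fixes 0, so the Schwarz lemma applies; solving back
  for \<open>g\<close> gives the bound.\<close>

lemma Borel_Caratheodory_unit_disc: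
  assumes f: "f holomorphic_on ball 0 1" and Re: "\<And>z. norm z < 1 \<Longrightarrow> Re (f z) < A"
    and z: "norm z < 1"
  shows "norm (f z - f 0) \<le> 2 * norm z / (1 - norm z) * (A - Re (f 0))"
proof -
  define M where "M = A - Re (f 0)"
  have M: "M > 0" using Re[of 0] by (simp add: M_def)
  define g where "g w = f w - f 0" for w
  have Reg: "Re (g w) < M" if "norm w < 1" for w using Re[OF that] by (simp add: g_def M_def)
  have lt: "norm (g w) < norm (2 * M - g w)" if "norm w < 1" for w
  proof -
    have "(norm (2 * M - g w))\<^sup>2 - (norm (g w))\<^sup>2 = 4 * M * (M - Re (g w))"
      unfolding cmod_power2 by (simp add: power2_eq_square algebra_simps)
    also have "\<dots> > 0" using M Reg[OF that] by simp
    finally show ?thesis by (simp add: power_less_imp_less_base)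
  qed
  define w where "w u = g u / (2 * M - g u)" for u
  have nz: "2 * M - g u \<noteq> 0" if "norm u < 1" for u using lt[OF that] by auto
  have "w holomorphic_on ball 0 1"
    unfolding w_def g_def using nz by (intro holomorphic_intros f) (auto simp: g_def)
  moreover have "w 0 = 0" by (simp add: w_def g_def)
  moreover have "norm (w u) < 1" if "norm u < 1" for u
    using lt[OF that] nz[OF that] by (simp add: w_def norm_divide)
  ultimately have wz: "norm (w z) \<le> norm z" using Schwarz_Lemma(1) z by blast
  have "g z * (1 + w z) = 2 * M * w z" using nz[OF z] by (simp add: w_def field_simps)
  hence "norm (g z) * norm (1 + w z) = 2 * M * norm (w z)" 
    using M by (metis norm_mult norm_of_real abs_of_pos mult_pos_pos zero_less_numeral of_real_mult of_real_numeral)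
  moreover have "norm (1 + w z) \<ge> 1 - norm z"
    using wz norm_diff_ineq[of 1 "w z"] by simp
  ultimately have "norm (g z) * (1 - norm z) \<le> 2 * M * norm z"
    using wz M by (smt (verit) mult_left_mono norm_ge_zero)
  thus ?thesis using z by (simp add: g_def M_def field_simps)
qed

text \<open>Dividing by Blaschke factors removes the zeros of \<open>V\<close> in the disc; it keeps the bounds
  on the circle and only increases \<open>norm (V 0)\<close>.\<close>
lemma exponent_bound_unit_disc:
  fixes V k :: "complex \<Rightarrow> complex"
  assumes "V holomorphic_on UNIV" and k: "k holomorphic_on UNIV" and "V 0 \<noteq> 0"
    and "\<And>z. norm z = 1 \<Longrightarrow> norm (V z) \<le> B" "\<And>z. norm z = 1 \<Longrightarrow> norm (V z * exp (k z)) \<le> B"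
    and z: "norm z < 1"
  shows "norm (k z - k 0) \<le> 2 * norm z / (1 - norm z) * (2 * ln B + 2 - 2 * ln (norm (V 0)) - Re (k 0))"
  using assms(1,3-5)
proof (induction "card {z \<in> ball 0 1. V z = 0}" arbitrary: V rule: less_induct)
  case (less V)
  have fin: "finite {z \<in> ball 0 1. V z = 0}"
  proof -
    have "\<not> V constant_on UNIV \<or> (\<forall>z. V z \<noteq> 0)" using less.prems(2) unfolding constant_on_def by force
    moreover have "finite {z \<in> cball 0 1. V z = 0}" if "\<not> V constant_on UNIV"
      using holomorphic_compact_finite_zeros[OF less.prems(1) open_UNIV connected_UNIV _ _ that, of "cball 0 1"] by simp
    ultimately have "finite {z \<in> cball 0 1. V z = 0}" by fastforce
    thus ?thesis by (rule finite_subset[rotated]) auto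
  qed
  show ?case
  proof (cases "\<exists>c\<in>ball 0 1. V c = 0")
    case True
    then obtain c where c: "norm c < 1" "V c = 0" by auto
    obtain n W where W: "W holomorphic_on UNIV" "W c \<noteq> 0" "\<And>z. V z = (z - c) ^ n * W z"
      using holomorphic_factor_power[OF less.prems(1,2)] by blast
    define V1 where "V1 z = (1 - cnj c * z) ^ n * W z" for z
    have V1: "V1 holomorphic_on UNIV" unfolding V1_def by (intro holomorphic_intros W(1))
    have nz: "1 - cnj c * z \<noteq> 0" if "norm z < 1" for z
    proof
      assume "1 - cnj c * z = 0"
      hence "norm (cnj c * z) = 1" by simp
      moreover have "norm (cnj c * z) < 1" using mult_left_mono[of "norm z" 1 "norm c"] c(1) that by (simp add: norm_mult)
      ultimately show False by simp
    qed
    \<comment> \<open>On the unit circle \<open>cnj z = 1 / z\<close>, so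
      \<open>1 - cnj c * z\<close> and \<open>z - c\<close> have the same modulus.\<close>
    have eq: "norm (V1 z) = norm (V z)" if "norm z = 1" for z
    proof -
      have "z * cnj z = 1" using that by (simp add: complex_norm_square[symmetric])
      hence "1 - cnj c * z = z * cnj (z - c)" by (simp add: algebra_simps)
      hence "norm (1 - cnj c * z) = norm (z - c)" using that by (simp only: norm_mult complex_mod_cnj)
      thus ?thesis by (simp add: V1_def W(3) norm_mult norm_power)
    qed
    have V0: "norm (V 0) \<le> norm (V1 0)" 
    proof -
      have "norm c ^ n \<le> 1" using c(1) by (intro power_le_one) auto
      thus ?thesis using mult_right_mono[of "norm c ^ n" 1 "norm (W 0)"] 
        by (simp add: V1_def W(3) norm_mult norm_power)
    qed
    have "norm (k z - k 0) \<le> 2 * norm z / (1 - norm z) * (2 * ln B + 2 - 2 * ln (norm (V1 0)) - Re (k 0))"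
    proof (rule less.hyps)
      have "{z \<in> ball 0 1. V1 z = 0} \<subseteq> {z \<in> ball 0 1. V z = 0} - {c}"
        using nz W(2) c(1) by (auto simp: V1_def W(3))
      hence "{z \<in> ball 0 1. V1 z = 0} \<subset> {z \<in> ball 0 1. V z = 0}" using c by auto
      thus "card {z \<in> ball 0 1. V1 z = 0} < card {z \<in> ball 0 1. V z = 0}"
        using fin psubset_card_mono by blast
      show "V1 0 \<noteq> 0" using V0 less.prems(2) by auto
      show "norm (V1 z) \<le> B" if "norm z = 1" for z using eq less.prems(3) that by simp
      show "norm (V1 z * exp (k z)) \<le> B" if "norm z = 1" for z 
        using eq less.prems(4) that by (simp add: norm_mult)
    qed (rule V1)
    also have "\<dots> \<le> 2 * norm z / (1 - norm z) * (2 * ln B + 2 - 2 * ln (norm (V 0)) - Re (k 0))"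
    proof (intro mult_left_mono)
      have "ln (norm (V 0)) \<le> ln (norm (V1 0))" using V0 less.prems(2) by (intro ln_mono) auto
      thus "2 * ln B + 2 - 2 * ln (norm (V1 0)) - Re (k 0) \<le> 2 * ln B + 2 - 2 * ln (norm (V 0)) - Re (k 0)" by simp
    qed (use z in auto)
    finally show ?thesis .
  next
    case False
    have bd: "norm (U z) \<le> B" if "U holomorphic_on UNIV" "\<And>z. norm z = 1 \<Longrightarrow> norm (U z) \<le> B" "norm z < 1" for U :: "complex \<Rightarrow> complex" and z
      using maximum_modulus_frontier[of U "cball 0 1" B z] that
      by (auto simp: holomorphic_on_imp_continuous_on holomorphic_on_subset)
    \<comment> \<open>Without zeros in the disc, \<open>V = exp v\<close>. By the maximum modulus
      principle \<open>v\<close> and \<open>v + k\<close> both have real part at most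
      \<open>ln B\<close>, and \<open>k\<close> is their difference. The extra 1 in the two bounds
      below makes the inequality strict.\<close>
    obtain v where v: "v holomorphic_on ball 0 1" "\<And>z. z \<in> ball 0 1 \<Longrightarrow> V z = exp (v z)"
      using contractible_imp_holomorphic_log[of V "ball 0 1"] False less.prems(1) 
      by (metis convex_ball convex_imp_contractible holomorphic_on_subset subset_UNIV)
    have "0 < norm (V 0)" "norm (V 0) \<le> B" using bd[of V 0] less.prems by auto
    hence B: "B > 0" by linarith
    have Rev: "Re (v 0) = ln (norm (V 0))" using v(2)[of 0] by simp
    have 1: "norm (v z - v 0) \<le> 2 * norm z / (1 - norm z) * (ln B + 1 - Re (v 0))"
    proof (rule Borel_Caratheodory_unit_disc[OF v(1) _ z])
      fix u :: complex assume u: "norm u < 1"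
      have "exp (Re (v u)) \<le> B" using bd[of V u] less.prems u v(2)[of u] by simp
      hence "Re (v u) \<le> ln B" using B by (simp add: ln_ge_iff)
      thus "Re (v u) < ln B + 1" by simp
    qed
    have 2: "norm ((v z + k z) - (v 0 + k 0)) \<le> 2 * norm z / (1 - norm z) * (ln B + 1 - Re (v 0 + k 0))"
    proof (rule Borel_Caratheodory_unit_disc[OF _ _ z])
      show "(\<lambda>z. v z + k z) holomorphic_on ball 0 1"
        by (intro holomorphic_intros v(1) holomorphic_on_subset[OF k]) auto
      fix u :: complex assume u: "norm u < 1"
      have "norm (V u * exp (k u)) \<le> B"
      proof (rule bd[of "\<lambda>u. V u * exp (k u)"])
        show "(\<lambda>u. V u * exp (k u)) holomorphic_on UNIV" by (intro holomorphic_intros less.prems(1) k)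
      qed (use less.prems(4) u in auto)
      hence "exp (Re (v u + k u)) \<le> B" using v(2)[of u] u by (simp add: norm_mult exp_add)
      hence "Re (v u + k u) \<le> ln B" using B by (simp only: ln_ge_iff)
      thus "Re (v u + k u) < ln B + 1" by simp
    qed
    have "norm (k z - k 0) \<le> norm ((v z + k z) - (v 0 + k 0)) + norm (v z - v 0)"
      using norm_triangle_ineq4[of "(v z + k z) - (v 0 + k 0)" "v z - v 0"] by (simp add: algebra_simps)
    also have "\<dots> \<le> 2 * norm z / (1 - norm z) * (ln B + 1 - Re (v 0 + k 0)) + 2 * norm z / (1 - norm z) * (ln B + 1 - Re (v 0))"
      by (intro add_mono 1 2)
    also have "\<dots> = 2 * norm z / (1 - norm z) * (2 * ln B + 2 - 2 * ln (norm (V 0)) - Re (k 0))"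
      unfolding distrib_left[symmetric] Rev[symmetric] by simp
    finally show ?thesis .
  qed
qed

lemma holomorphic_on_affine:
  fixes f :: "complex \<Rightarrow> complex"
  assumes "f holomorphic_on UNIV"
  shows "(\<lambda>z. f (p + c * z)) holomorphic_on UNIV"
proof -
  have "(\<lambda>z. p + c * z) holomorphic_on UNIV" by (intro holomorphic_intros)
  from holomorphic_on_compose_gen[OF this assms] show ?thesis by (simp add: o_def)
qed

lemma exponent_bound_disc:
  fixes V k :: "complex \<Rightarrow> complex"
  assumes V: "V holomorphic_on UNIV" and k: "k holomorphic_on UNIV" and "V p \<noteq> 0"
    and B: "\<And>z. norm (z - p) = r \<Longrightarrow> norm (V z) \<le> B" "\<And>z. norm (z - p) = r \<Longrightarrow> norm (V z * exp (k z)) \<le> B"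
    and z: "norm (z - p) \<le> s" and sr: "0 \<le> s" "s < r"
  shows "norm (k z) \<le> norm (k p) + 2 * r / (r - s) * (2 * \<bar>ln B\<bar> + 2 + 2 * \<bar>ln (norm (V p))\<bar> + norm (k p))"
proof -
  have r0: "r > 0" using sr by simp
  define u where "u = (z - p) / r"
  have nu: "norm u = norm (z - p) / r" using r0 by (simp add: u_def norm_divide)
  have "norm (z - p) < r" using z sr by simp
  hence u1: "norm u < 1" using r0 by (simp add: nu)
  have "norm (k (p + complex_of_real r * u) - k (p + complex_of_real r * 0)) \<le> 2 * norm u / (1 - norm u) *
      (2 * ln B + 2 - 2 * ln (norm (V (p + complex_of_real r * 0))) - Re (k (p + complex_of_real r * 0)))"
    by (rule exponent_bound_unit_disc[of "\<lambda>z. V (p + r * z)" "\<lambda>z. k (p + r * z)"])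
       (use assms holomorphic_on_affine u1 r0 in \<open>auto simp: norm_mult\<close>)
  also have "p + r * u = z" using r0 by (simp add: u_def)
  finally have "norm (k z - k p) \<le> 2 * norm u / (1 - norm u) * (2 * ln B + 2 - 2 * ln (norm (V p)) - Re (k p))" by simp
  also have "\<dots> \<le> 2 * r / (r - s) * (2 * \<bar>ln B\<bar> + 2 + 2 * \<bar>ln (norm (V p))\<bar> + norm (k p))"
  proof (rule order_trans[OF mult_left_mono mult_right_mono])
    show "2 * ln B + 2 - 2 * ln (norm (V p)) - Re (k p) \<le> 2 * \<bar>ln B\<bar> + 2 + 2 * \<bar>ln (norm (V p))\<bar> + norm (k p)"
      using abs_Re_le_cmod[of "k p"] by linarith
    have "2 * norm u / (1 - norm u) = 2 * norm (z - p) / (r - norm (z - p))"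
      using r0 u1 by (simp add: nu field_simps)
    also have "\<dots> \<le> 2 * r / (r - s)" using z sr by (intro frac_le) auto
    finally show "2 * norm u / (1 - norm u) \<le> 2 * r / (r - s)" .
  qed (use u1 in auto)
  finally show ?thesis using norm_triangle_sub[of "k z" "k p"] by linarith
qed

section \<open>Bounds for inner functions and for iterated logarithms\<close>

lemma nonconstant_exceeds_on_circles:
  fixes M :: "complex \<Rightarrow> complex"
  assumes M: "M holomorphic_on UNIV" and nc: "\<not> M constant_on UNIV"
  obtains c where "c > 0" "\<And>K \<sigma>. K \<ge> 0 \<Longrightarrow> \<sigma> \<ge> c * (K + 1) \<Longrightarrow> \<exists>w. norm (w - q) = \<sigma> \<and> norm (M w) > K"
proof -
  \<comment> \<open>If \<open>M\<close> were bounded by \<open>K\<close> on the circle of radius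
    \<open>\<sigma>\<close>, Cauchy's inequality for this Taylor coefficient would give
    \<open>b * \<sigma> ^ j \<le> K\<close>. The constant \<open>1 + 1 / b\<close> ensures
    \<open>\<sigma> \<ge> 1\<close> and \<open>b * \<sigma> \<ge> K + 1\<close>.\<close>
  have "\<exists>j>0. (deriv ^^ j) M q \<noteq> 0"
  proof (rule ccontr)
    assume no: "\<not> ?thesis"
    have "M w = M q" for w
    proof (rule holomorphic_fun_eq_const_on_connected[OF M open_UNIV connected_UNIV])
      show "(deriv ^^ n) M q = 0" if "0 < n" for n using no that by blast
    qed auto
    thus False using nc unfolding constant_on_def by blast
  qed
  then obtain j where j: "j > 0" "(deriv ^^ j) M q \<noteq> 0" by blast
  define b where "b = norm ((deriv ^^ j) M q) / fact j"
  have b: "b > 0" using j by (simp add: b_def)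
  show ?thesis
  proof (rule that[of "1 + 1 / b"])
    show "1 + 1 / b > 0" using b by (simp add: add_pos_pos)
    fix K \<sigma> :: real assume K: "K \<ge> 0" and \<sigma>: "\<sigma> \<ge> (1 + 1 / b) * (K + 1)"
    have "(1 + 1 / b) * (K + 1) = (K + 1) + (K + 1) / b" by (simp add: algebra_simps)
    hence \<sigma>1: "\<sigma> \<ge> 1" and \<sigma>2: "\<sigma> \<ge> (K + 1) / b" 
      using \<sigma> K b divide_nonneg_pos[of "K + 1" b] by linarith+
    show "\<exists>w. norm (w - q) = \<sigma> \<and> norm (M w) > K"
    proof (rule ccontr)
      assume "\<not> ?thesis"
      hence le: "\<And>x. norm (q - x) = \<sigma> \<Longrightarrow> norm (M x) \<le> K" by (force simp: norm_minus_commute)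
      have "norm ((deriv ^^ j) M q) \<le> fact j * K / \<sigma> ^ j"
        using M \<sigma>1 le by (intro Cauchy_inequality holomorphic_on_imp_continuous_on) (auto elim: holomorphic_on_subset)
      hence "b \<le> K / \<sigma> ^ j" by (simp add: b_def field_simps)
      hence "b * \<sigma> ^ j \<le> K" using \<sigma>1 by (simp add: field_simps)
      moreover have "b * \<sigma> \<le> b * \<sigma> ^ j" using b \<sigma>1 j(1) self_le_power[of \<sigma> j] by simp
      moreover have "b * \<sigma> \<ge> K + 1" using \<sigma>2 b by (simp add: field_simps)
      ultimately show False by linarith
    qed
  qed
qed

text \<open>If \<open>M \<circ> g\<close> is bounded by \<open>K\<close> then \<open>g\<close> omits one point on each of two circles
  of radius comparable to \<open>K + 1\<close>.\<close>
lemma inner_function_bound: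
  fixes M g :: "complex \<Rightarrow> complex"
  assumes M: "M holomorphic_on UNIV" and nc: "\<not> M constant_on UNIV" and g: "g holomorphic_on UNIV"
  shows "\<exists>c>0. \<forall>K r t z. 0 \<le> K \<and> 0 < r \<and> 0 < t \<and> t < 1 \<and>
    (\<forall>z. norm (z - p) \<le> r \<longrightarrow> norm (M (g z)) \<le> K) \<and> norm (z - p) \<le> t * r \<longrightarrow>
    norm (g z) \<le> c * (K + 1) * exp (pi * exp (pi * (4 + 12 * t / (1 - t))))"
proof -
  obtain c where c: "c > 0" "\<And>K \<sigma>. K \<ge> 0 \<Longrightarrow> \<sigma> \<ge> c * (K + 1) \<Longrightarrow> \<exists>w. norm (w - g p) = \<sigma> \<and> norm (M w) > K"
    using nonconstant_exceeds_on_circles[OF M nc] by metis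
  show ?thesis
  proof (intro exI[of _ "norm (g p) + 4 * c"] conjI allI impI; (elim conjE)?)
    show "norm (g p) + 4 * c > 0" using c by (simp add: add_nonneg_pos)
    fix K r t :: real and z
    assume K: "0 \<le> K" and r: "0 < r" and t: "0 < t" "t < 1"
      and bd': "\<forall>z. norm (z - p) \<le> r \<longrightarrow> norm (M (g z)) \<le> K" and z: "norm (z - p) \<le> t * r"
    note bd = bd'[rule_format]
    define \<sigma> where "\<sigma> = c * (K + 1)"
    have \<sigma>: "\<sigma> > 0" using c K by (simp add: \<sigma>_def)
    \<comment> \<open>With radii \<open>\<sigma>\<close> and \<open>2 * \<sigma>\<close> the omitted
      points have distance between \<open>\<sigma>\<close> and \<open>3 * \<sigma>\<close>. The
      normalized function \<open>f\<close> then satisfies \<open>norm (f 0) \<le> 1\<close>,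
      uniformly in \<open>K\<close>, and omits 0 and 1.\<close>
    obtain w1 where w1: "norm (w1 - g p) = \<sigma>" "norm (M w1) > K" using c(2)[OF K, of \<sigma>] by (auto simp: \<sigma>_def)
    obtain w2 where w2: "norm (w2 - g p) = 2 * \<sigma>" "norm (M w2) > K" using c(2)[OF K, of "2 * \<sigma>"] \<sigma> by (auto simp: \<sigma>_def)
    have d: "norm (w2 - w1) \<ge> \<sigma>" "norm (w2 - w1) \<le> 3 * \<sigma>"
      using norm_triangle_ineq2[of "w2 - g p" "w1 - g p"] norm_triangle_ineq4[of "w2 - g p" "w1 - g p"] w1 w2 by simp_all
    hence ne: "w2 - w1 \<noteq> 0" using \<sigma> by auto
    define f where "f u = (g (p + r * u) - w1) / (w2 - w1)" for u :: complex
    define X where "X = exp (pi * exp (pi * (4 + 12 * t / (1 - t))))"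
    define u where "u = (z - p) / r"
    have zu: "p + r * u = z" using r by (simp add: u_def)
    have "norm (f u) \<le> exp (pi * exp (pi * (2 + 2 * 1 + 12 * t / (1 - t))))"
    proof (rule Schottky[of f 1 t u])
      show "0 < t" "t < 1" by (fact t)+
      have "(\<lambda>z. g (p + r * z)) holomorphic_on UNIV"
        by (rule holomorphic_on_affine[OF g])
      hence "f holomorphic_on UNIV"
        unfolding f_def using ne by (intro holomorphic_intros) auto
      thus "f holomorphic_on cball 0 1" by (rule holomorphic_on_subset) simp
      have "norm (g p - w1) = \<sigma>" using w1(1) by (simp add: norm_minus_commute)
      thus "norm (f 0) \<le> 1" using d(1) \<sigma> ne by (simp add: f_def norm_divide field_simps)
      show "\<not> (f u = 0 \<or> f u = 1)" if "u \<in> cball 0 1" for u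
      proof -
        have "norm ((p + r * u) - p) \<le> r" using that r by (simp add: norm_mult mult_le_cancel_left1)
        hence "norm (M (g (p + r * u))) \<le> K" by (rule bd)
        hence "g (p + r * u) \<noteq> w1" "g (p + r * u) \<noteq> w2" using w1(2) w2(2) by auto
        thus ?thesis using ne by (auto simp: f_def)
      qed
      show "norm u \<le> t" using z r by (simp add: u_def norm_divide field_simps)
    qed
    hence fX: "norm (f u) \<le> X" by (simp add: X_def)
    have X1: "X \<ge> 1" by (simp add: X_def)
    have "g z - w1 = (w2 - w1) * f u" using ne by (simp add: f_def zu)
    hence "norm (g z - w1) = norm (w2 - w1) * norm (f u)" by (simp add: norm_mult)
    also have "\<dots> \<le> (3 * \<sigma>) * X" using d(2) fX \<sigma> by (intro mult_mono) auto
    finally have "norm (g z - w1) \<le> 3 * \<sigma> * X" .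
    hence "norm (g z) \<le> norm (g p) + \<sigma> + 3 * \<sigma> * X"
      using norm_triangle_sub[of "g z" w1] norm_triangle_sub[of w1 "g p"] w1(1) by linarith
    also have "\<dots> \<le> norm (g p) * X + \<sigma> * X + 3 * \<sigma> * X"
      using X1 \<sigma> by (intro add_mono) (simp_all add: mult_le_cancel_left1)
    also have "\<dots> = (norm (g p) + 4 * \<sigma>) * X" by (simp add: algebra_simps)
    also have "\<dots> \<le> ((norm (g p) + 4 * c) * (K + 1)) * X"
      using X1 K mult_left_mono[of 1 "K + 1" "norm (g p)"] by (intro mult_right_mono) (auto simp: \<sigma>_def algebra_simps)
    finally show "norm (g z) \<le> (norm (g p) + 4 * c) * (K + 1) * exp (pi * exp (pi * (4 + 12 * t / (1 - t))))"
      by (simp add: X_def)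
  qed
qed

text \<open>Otherwise \<open>K (Suc j)\<close> is roughly the exponential of \<open>K j\<close>, and iterated exponentials
  outgrow the constants \<open>exp (c * 2 ^ j)\<close>.\<close>
lemma bounded_iterated_log_bound:
  fixes K :: "nat \<Rightarrow> real"
  assumes step: "\<And>j. K j \<le> exp (c * 2 ^ j) * (R + ln (2 + K (Suc j)))"
    and K: "\<And>j. 0 \<le> K j" "\<And>j. K j \<le> b" and c: "c \<ge> 1" and R: "R \<ge> 1"
  shows "K 0 \<le> exp c * (3 * R + 6 * c)"
proof (rule ccontr)
  assume *: "\<not> ?thesis"
  \<comment> \<open>\<open>R + Y 0\<close> is the claimed bound without its factor
    \<open>exp c\<close>. With \<open>x = c * 2 ^ j\<close>, the exponential of \<open>Y j\<close>
    splits into \<open>exp (2 * x)\<close>, the factor belonging to \<open>Suc j\<close>, and a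
    second factor exceeding \<open>R + Y (Suc j)\<close>.\<close>
  define Y where "Y j = 6 * c * 2 ^ j + 2 * R" for j :: nat
  have big: "K j > exp (c * 2 ^ j) * (R + Y j)" for j
  proof (induction j)
    case 0
    show ?case using * by (simp add: Y_def algebra_simps)
  next
    case (Suc j)
    define x where "x = c * 2 ^ j"
    have x: "x \<ge> 1" using c mult_mono[of 1 c 1 "2 ^ j :: real"] by (simp add: x_def)
    have "exp (c * 2 ^ j) * (R + Y j) < exp (c * 2 ^ j) * (R + ln (2 + K (Suc j)))"
      using Suc step[of j] by linarith
    hence "Y j < ln (2 + K (Suc j))" by simp
    hence "exp (Y j) < 2 + K (Suc j)" using K(1)[of "Suc j"]
      by (metis add_pos_nonneg exp_less_mono exp_ln zero_less_numeral)
    moreover have "exp (Y j) - 2 \<ge> exp (2 * x) * (3 * R + 12 * x)"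
    proof -
      define y where "y = 4 * x + 2 * R"
      have y: "y \<ge> 6" using x R by (simp add: y_def)
      have "exp y \<ge> 1 + y + y\<^sup>2 / 2" using exp_lower_Taylor_quadratic[of y] y by simp
      moreover have "y\<^sup>2 / 2 \<ge> 3 * y" using y by (simp add: power2_eq_square)
      ultimately have ey: "exp y \<ge> (3 * R + 12 * x) + 2" using x R by (simp add: y_def)
      have "exp (Y j) = exp (2 * x) * exp y"
        by (simp add: Y_def y_def x_def exp_add[symmetric] algebra_simps)
      also have "\<dots> \<ge> exp (2 * x) * ((3 * R + 12 * x) + 2)" using ey by (intro mult_left_mono) auto
      finally have "exp (Y j) \<ge> exp (2 * x) * (3 * R + 12 * x) + exp (2 * x) * 2" by (simp add: algebra_simps)
      moreover have "exp (2 * x) \<ge> 1" using x by simp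
      ultimately show ?thesis by linarith
    qed
    ultimately have "K (Suc j) > exp (2 * x) * (3 * R + 12 * x)" by linarith
    thus ?case by (simp add: Y_def x_def algebra_simps)
  qed
  obtain j :: nat where j: "real j > b" using reals_Archimedean2 by blast
  have "Y j \<ge> 0" using R c by (simp add: Y_def)
  hence "R + Y j \<ge> 1" using R by simp
  have "real j \<le> 2 ^ j" using of_nat_less_two_power[of j, where 'a = real] by linarith
  also have "\<dots> \<le> c * 2 ^ j" using c by simp
  also have "\<dots> \<le> exp (c * 2 ^ j)" using exp_ge_add_one_self[of "c * 2 ^ j"] by linarith
  also have "\<dots> \<le> exp (c * 2 ^ j) * (R + Y j)" using \<open>R + Y j \<ge> 1\<close> by (simp add: mult_le_cancel_left1)
  also have "\<dots> < K j" by (rule big)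
  also have "\<dots> \<le> b" by (rule K(2))
  finally show False using j by simp
qed

lemma norm_deriv_le:
  assumes f: "f holomorphic_on UNIV" and "\<delta> > 0" and S: "\<And>w. norm (w - z) \<le> \<delta> \<Longrightarrow> norm (f w) \<le> S"
  shows "norm (deriv f z) \<le> S / \<delta>"
proof -
  have "norm ((deriv ^^ 1) f z) \<le> fact 1 * S / \<delta> ^ 1"
  proof (rule Cauchy_inequality)
    show "f holomorphic_on ball z \<delta>" using f by (rule holomorphic_on_subset) simp
    show "continuous_on (cball z \<delta>) f" using holomorphic_on_imp_continuous_on[OF f] by (rule continuous_on_subset) simp
    show "norm (f x) \<le> S" if "norm (z - x) = \<delta>" for x using that S[of x] by (simp add: norm_minus_commute)
  qed fact
  thus ?thesis by simp
qed

text \<open>In the application the inner functions are \<open>g z\<close> and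
  \<open>g (\<pi> - z)\<close>, the summands are \<open>F' z\<close> and
  \<open>- F' (\<pi> - z)\<close>, and \<open>C z\<close> is \<open>2 * a * cos z\<close>. The index
  type \<open>bool\<close> lets each estimate be proved once for both. The point \<open>p\<close> is
  the centre of all discs and will be placed where \<open>V\<close> does not vanish.\<close>

locale two_exponentials =
  fixes g :: "bool \<Rightarrow> complex \<Rightarrow> complex" and M C :: "complex \<Rightarrow> complex" and w0 p :: complex and n :: nat and \<gamma> :: real
  assumes hol_g: "g i holomorphic_on UNIV" and hol_M: "M holomorphic_on UNIV" and hol_C: "C holomorphic_on UNIV"
    and M_nonconst: "\<not> M constant_on UNIV"
    and identity: "\<And>z. (g True z - w0) ^ n * deriv (g True) z * exp (M (g True z))
                     + (g False z - w0) ^ n * deriv (g False) z * exp (M (g False z)) = C z"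
    and C_bound: "\<And>z. norm (C z) \<le> \<gamma> * exp (norm z)" "\<And>z. norm (deriv C z) \<le> \<gamma> * exp (norm z)"
begin

definition "k i z = M (g i z)"
definition "A i z = (g i z - w0) ^ n * deriv (g i) z"
text \<open>The derivative of the summand \<open>A i z * exp (k i z)\<close> is
  \<open>B i z * exp (k i z)\<close>.\<close>

definition "B i z = deriv (A i) z + deriv (k i) z * A i z"
text \<open>Up to sign the Wronskian of the two summands, stripped of its exponential
  factors.\<close>

definition "V z = B True z * A False z - A True z * B False z"
definition "K r = Sup ((\<lambda>z. norm (k True z) + norm (k False z)) ` cball p r)"

lemma hol_k: "k i holomorphic_on UNIV"
  using holomorphic_on_compose_gen[OF hol_g hol_M, of i] by (simp add: k_def[abs_def] o_def)

lemma hol_A: "A i holomorphic_on UNIV"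
  unfolding A_def by (intro holomorphic_intros hol_g) auto

lemma hol_B: "B i holomorphic_on UNIV"
  unfolding B_def by (intro holomorphic_intros hol_A hol_k) auto

lemma hol_V: "V holomorphic_on UNIV"
  unfolding V_def by (intro holomorphic_intros hol_A hol_B)

lemma identity_deriv:
  "A True z * exp (k True z) + A False z * exp (k False z) = C z"
  "B True z * exp (k True z) + B False z * exp (k False z) = deriv C z"
proof -
  show "A True z * exp (k True z) + A False z * exp (k False z) = C z" for z
    using identity[of z] by (simp add: A_def k_def)
  hence *: "(\<lambda>z. A True z * exp (k True z) + A False z * exp (k False z)) = C" by auto
  have d: "((\<lambda>z. A i z * exp (k i z)) has_field_derivative B i z * exp (k i z)) (at z)" for i
  proof -
    have "((\<lambda>z. A i z * exp (k i z)) has_field_derivative (deriv (A i) z * exp (k i z) + (exp (k i z) * deriv (k i) z) * A i z)) (at z)"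
      by (intro DERIV_mult DERIV_fun_exp holomorphic_derivI[OF hol_A] holomorphic_derivI[OF hol_k]) auto
    thus ?thesis by (simp add: B_def algebra_simps)
  qed
  from DERIV_imp_deriv[OF DERIV_add[OF d[of True] d[of False]]]
  show "B True z * exp (k True z) + B False z * exp (k False z) = deriv C z"
    unfolding * by (rule sym)
qed

text \<open>The identity and its derivative form a linear system for the two exponentials, with
  determinant \<open>V\<close> up to sign. Hence \<open>V * exp (k i)\<close>, like \<open>V\<close>
  itself, has a bound free of exponentials of \<open>k\<close>, which is the input for
  \<open>exponent_bound_disc\<close>.\<close>

lemma Cramer:
  "V z * exp (k True z) = deriv C z * A False z - C z * B False z"
  "V z * exp (k False z) = C z * B True z - deriv C z * A True z"
  unfolding identity_deriv[symmetric] V_def by (simp_all add: algebra_simps)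

text \<open>As \<open>C\<close> is the sum of both summands, the Wronskian of the first summand with
  \<open>C\<close> equals that of the two summands, which is \<open>V\<close> times two
  exponentials.\<close>

lemma V_nonzero:
  assumes "deriv (\<lambda>z. A True z * exp (k True z)) z * C z \<noteq> A True z * exp (k True z) * deriv C z"
  shows "V z \<noteq> 0"
proof -
  have "((\<lambda>z. A True z * exp (k True z)) has_field_derivative (deriv (A True) z * exp (k True z) + (exp (k True z) * deriv (k True) z) * A True z)) (at z)"
    by (intro DERIV_mult DERIV_fun_exp holomorphic_derivI[OF hol_A] holomorphic_derivI[OF hol_k]) auto
  hence "deriv (\<lambda>z. A True z * exp (k True z)) z = B True z * exp (k True z)"
    by (simp add: DERIV_imp_deriv B_def algebra_simps)
  hence "deriv (\<lambda>z. A True z * exp (k True z)) z * C z - A True z * exp (k True z) * deriv C z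
      = V z * exp (k True z) * exp (k False z)"
    unfolding identity_deriv[symmetric] V_def by (simp add: algebra_simps)
  thus ?thesis using assms by auto
qed

lemma K_bdd: "bdd_above ((\<lambda>z. norm (k True z) + norm (k False z)) ` cball p r)"
proof -
  have "continuous_on (cball p r) (\<lambda>z. norm (k True z) + norm (k False z))"
    by (intro continuous_intros continuous_on_subset[OF holomorphic_on_imp_continuous_on[OF hol_k]]) auto
  hence "compact ((\<lambda>z. norm (k True z) + norm (k False z)) ` cball p r)"
    by (rule compact_continuous_image) simp
  thus ?thesis by (intro bounded_imp_bdd_above compact_imp_bounded)
qed

lemma k_le_K: "norm (z - p) \<le> r \<Longrightarrow> norm (k i z) \<le> K r"
proof -
  assume "norm (z - p) \<le> r"
  hence "norm (k True z) + norm (k False z) \<le> K r"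
    unfolding K_def by (intro cSUP_upper K_bdd) (simp add: dist_norm norm_minus_commute)
  thus ?thesis by (cases i) (auto intro: order_trans[rotated])
qed

lemma K_le:
  assumes "r \<ge> 0" "\<And>z i. norm (z - p) \<le> r \<Longrightarrow> norm (k i z) \<le> b i"
  shows "K r \<le> b True + b False"
  unfolding K_def
proof (rule cSUP_least)
  show "cball p r \<noteq> {}" using assms(1) by simp
  show "norm (k True z) + norm (k False z) \<le> b True + b False" if "z \<in> cball p r" for z
    using that by (intro add_mono assms(2)) (simp_all add: dist_norm norm_minus_commute)
qed

lemma K_nonneg: "r \<ge> 0 \<Longrightarrow> K r \<ge> 0"
  by (rule order_trans[OF norm_ge_zero[of "k True p"] k_le_K]) simp

lemma K_mono: "0 \<le> r \<Longrightarrow> r \<le> s \<Longrightarrow> K r \<le> K s"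
  unfolding K_def by (rule cSUP_subset_mono[OF _ K_bdd]) auto

text \<open>Four strips of width \<open>\<eta> * R\<close> are used up: one for Schottky, bounding
  \<open>g i\<close> in terms of \<open>K\<close>; two for Cauchy, bounding the derivatives in
  \<open>A i\<close> and \<open>B i\<close>; one for \<open>exponent_bound_disc\<close>, which
  returns to \<open>k i\<close>. The last step sees only the logarithm of the earlier bounds, hence
  \<open>ln (2 + K ...)\<close>; the summand \<open>R\<close> stems from the exponential bound on
  \<open>C\<close>.\<close>

lemma growth_step:
  assumes Vp: "V p \<noteq> 0"
  obtains c where "c \<ge> 1" "\<And>r R \<eta>. 0 < \<eta> \<Longrightarrow> \<eta> \<le> 1 \<Longrightarrow> 1 \<le> R \<Longrightarrow> R \<le> r \<Longrightarrow> r + 4 * (\<eta> * R) \<le> 2 * R \<Longrightarrow>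
     K r \<le> exp (c / \<eta>) * (R + ln (2 + K (r + 4 * (\<eta> * R))))"
proof -
  have "\<forall>i. \<exists>c>0. \<forall>K r t z. 0 \<le> K \<and> 0 < r \<and> 0 < t \<and> t < 1 \<and>
      (\<forall>z. norm (z - p) \<le> r \<longrightarrow> norm (M (g i z)) \<le> K) \<and> norm (z - p) \<le> t * r \<longrightarrow>
      norm (g i z) \<le> c * (K + 1) * exp (pi * exp (pi * (4 + 12 * t / (1 - t))))"
    (is "\<forall>i. \<exists>c. ?P i c")
    by (intro allI inner_function_bound[OF hol_M M_nonconst hol_g])
  hence "\<exists>d. \<forall>i. ?P i (d i)" by (rule choice)
  then obtain d where dP: "\<forall>i. ?P i (d i)" by (rule exE)
  have d1: "d i > 0" for i using dP[rule_format, of i] by (rule conjunct1)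
  note d2 = dP[rule_format, THEN conjunct2, rule_format]
  define c0 where "c0 = d True + d False"
  have c0: "c0 > 0" "d i \<le> c0" for i 
    using d1[of True] d1[of False] by (cases i; simp add: c0_def)+
  have \<gamma>: "\<gamma> \<ge> 0" using C_bound(1)[of 0] norm_ge_zero[of "C 0"] by (simp del: norm_ge_zero)
  define c3 where "c3 = ln (1 + norm w0 + c0)"
  define c4 where "c4 = ln (1 + \<gamma> * exp (norm p))"
  define c5 where "c5 = (real n + 1) * (c3 + 1 + pi) + 5 + c4"
  define \<kappa> where "\<kappa> = norm (k True p) + norm (k False p)"
  define c2 where "c2 = 2 * ln 2 + 2 + 2 * \<bar>ln (norm (V p))\<bar> + \<kappa>"
  define c6 where "c6 = 2 * \<kappa> + 8 * (4 * c5 + c2)"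
  have c3: "c3 \<ge> 0" using c0(1) by (simp add: c3_def)
  have c4: "c4 \<ge> 0" using \<gamma> by (simp add: c4_def)
  have c5: "c5 \<ge> 0" using c3 c4 by (simp add: c5_def)
  have \<kappa>: "\<kappa> \<ge> 0" by (simp add: \<kappa>_def)
  have c2: "c2 \<ge> 0" using \<kappa> by (simp add: c2_def)
  have c6: "c6 \<ge> 0" using c2 c5 \<kappa> by (simp add: c6_def)
  show ?thesis
  \<comment> \<open>The part \<open>56 * pi\<close> absorbs the Schottky factor:
    \<open>T\<^sup>2 = exp (8 * pi + 48 * pi * x)\<close> with \<open>x \<ge> 1\<close>.\<close>
  proof (rule that[of "c6 + 56 * pi"])
    show "c6 + 56 * pi \<ge> 1" using c6 pi_gt3 by linarith
    fix r R \<eta> :: real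
    assume \<eta>: "0 < \<eta>" "\<eta> \<le> 1" and R: "1 \<le> R" "R \<le> r" and r': "r + 4 * (\<eta> * R) \<le> 2 * R"
    define e where "e = \<eta> * R"
    have e: "0 < e" "\<eta> \<le> e" using \<eta> R by (simp_all add: e_def mult_le_cancel_left1)
    have r: "r + 4 * e \<le> 2 * R" using r' by (simp add: e_def)
    define K' where "K' = K (r + 4 * e)"
    have K': "K' \<ge> 0" unfolding K'_def using R e by (intro K_nonneg) simp
    have kK': "norm (k i z) \<le> K'" if "norm (z - p) \<le> r + 4 * e" for i z
      unfolding K'_def by (rule k_le_K) fact
    define x where "x = 1 / \<eta>"
    have x: "x \<ge> 1" using \<eta> by (simp add: x_def)
    define T where "T = exp (pi * (4 + 24 * x))"
    define S where "S = c0 * (K' + 1) * exp (pi * T)"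
    have S0: "S \<ge> 0" using c0 K' by (simp add: S_def)
    have S: "norm (g i z) \<le> S" if z: "norm (z - p) \<le> r + 3 * e" for i z
    proof -
      \<comment> \<open>Ratio of the two radii. Since all discs stay within radius
        \<open>2 * R\<close>, the quotient \<open>t / (1 - t)\<close> is at most
        \<open>2 / \<eta>\<close>.\<close>
      define t where "t = (r + 3 * e) / (r + 4 * e)"
      have den: "r + 4 * e > 0" using R e by simp
      have t: "0 < t" "t < 1" using R e den by (simp_all add: t_def)
      have "1 - t = e / (r + 4 * e)" using den by (simp add: t_def field_simps)
      hence "t / (1 - t) = (r + 3 * e) / (e)" using den by (simp add: t_def)
      also have "\<dots> \<le> 2 * R / (e)" using e r by (intro divide_right_mono) auto
      also have "\<dots> = 2 * x" using R by (simp add: x_def e_def)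
      finally have t2: "12 * t / (1 - t) \<le> 24 * x" by simp
      have "norm (g i z) \<le> d i * (K' + 1) * exp (pi * exp (pi * (4 + 12 * t / (1 - t))))"
      proof (rule d2, intro conjI allI impI K' den t)
        show "norm (M (g i z)) \<le> K'" if "norm (z - p) \<le> r + 4 * e" for z
          using kK'[OF that, of i] by (simp add: k_def)
        show "norm (z - p) \<le> t * (r + 4 * e)" using z den by (simp add: t_def)
      qed (fact den)
      also have "\<dots> \<le> S" unfolding S_def T_def
        using c0(2)[of i] d1[of i] K' t2 by (intro mult_mono) auto
      finally show ?thesis .
    qed
    define \<alpha> where "\<alpha> = (S + norm w0) ^ n * S * x"
    \<comment> \<open>Cauchy's estimates use discs of radius \<open>\<eta>\<close>, which fit into a
      strip of width \<open>e\<close> because \<open>R \<ge> 1\<close>.\<close>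
    have near: "norm (w - p) \<le> a + e" if "norm (w - z) \<le> \<eta>" "norm (z - p) \<le> a" for w z and a :: real
      using that e(2) norm_triangle_ineq[of "w - z" "z - p"] by simp
    have A: "norm (A i z) \<le> \<alpha>" if z: "norm (z - p) \<le> r + 2 * e" for i z
    proof -
      have "norm (deriv (g i) z) \<le> S / \<eta>"
        using near[OF _ z] by (intro norm_deriv_le[OF hol_g \<eta>(1)] S) (auto simp: algebra_simps)
      moreover have "norm (g i z) \<le> S" using z e by (intro S) simp
      hence "norm (g i z - w0) ^ n \<le> (S + norm w0) ^ n"
        using norm_triangle_ineq4[of "g i z" w0] by (intro power_mono) auto
      ultimately have "norm (A i z) \<le> (S + norm w0) ^ n * (S / \<eta>)"
        unfolding A_def norm_mult norm_power using S0 \<eta> by (intro mult_mono) auto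
      thus ?thesis by (simp add: \<alpha>_def x_def)
    qed
    have \<alpha>0: "\<alpha> \<ge> 0" using S0 x by (simp add: \<alpha>_def)
    define \<beta> where "\<beta> = \<alpha> * (1 + K') * x"
    have B: "norm (B i z) \<le> \<beta>" if z: "norm (z - p) \<le> r + e" for i z
    proof -
      have "norm (deriv (A i) z) \<le> \<alpha> / \<eta>"
        using near[OF _ z] by (intro norm_deriv_le[OF hol_A \<eta>(1)] A) (auto simp: algebra_simps)
      moreover have "norm (deriv (k i) z) \<le> K' / \<eta>"
        using near[OF _ z] e by (intro norm_deriv_le[OF hol_k \<eta>(1)] kK') force
      moreover have "norm (A i z) \<le> \<alpha>" using z e by (intro A) simp
      ultimately have "norm (deriv (A i) z) + norm (deriv (k i) z * A i z) \<le> \<alpha> / \<eta> + (K' / \<eta>) * \<alpha>"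
        unfolding norm_mult using K' \<eta> by (intro add_mono mult_mono) auto
      moreover have "\<alpha> / \<eta> + (K' / \<eta>) * \<alpha> = \<beta>" by (simp add: \<beta>_def x_def algebra_simps add_divide_distrib)
      ultimately show ?thesis unfolding B_def using norm_triangle_ineq order_trans by metis
    qed
    define \<Gamma> where "\<Gamma> = \<gamma> * exp (norm p + 2 * R)"
    have \<Gamma>0: "\<Gamma> \<ge> 0" using \<gamma> by (simp add: \<Gamma>_def)
    have \<Gamma>: "norm (C z) \<le> \<Gamma>" "norm (deriv C z) \<le> \<Gamma>" if "norm (z - p) \<le> r + e" for z
    proof -
      have "norm z \<le> norm p + 2 * R" using that r e norm_triangle_sub[of z p] by linarith
      hence "\<gamma> * exp (norm z) \<le> \<Gamma>" unfolding \<Gamma>_def using \<gamma> by (intro mult_left_mono) auto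
      thus "norm (C z) \<le> \<Gamma>" "norm (deriv C z) \<le> \<Gamma>" using C_bound[of z] by linarith+
    qed
    define s where "s = 1 + S + norm w0"
    have s: "s \<ge> 1" using S0 by (simp add: s_def)
    have sn: "s ^ (n + 1) \<ge> 1" using s by (rule one_le_power)
    have x2: "x\<^sup>2 \<ge> 1" "x \<le> x\<^sup>2" using x by (simp_all add: power2_eq_square mult_le_cancel_left1 mult_ge1_I)
    have \<alpha>E: "\<alpha> \<le> s ^ (n + 1) * x"
    proof -
      have "(S + norm w0) ^ n * S \<le> s ^ n * s" using S0 by (intro mult_mono power_mono) (auto simp: s_def)
      thus ?thesis unfolding \<alpha>_def using x by (intro mult_right_mono) (auto simp: mult.commute)
    qed
    define P where "P = s ^ (n + 1) * (1 + K') * x\<^sup>2"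
    have sK: "s ^ (n + 1) * (1 + K') \<ge> s ^ (n + 1)" using sn K' by (simp add: mult_le_cancel_left1)
    have P1: "P \<ge> 1" unfolding P_def using order_trans[OF sn sK] x2(1) mult_ge1_I by blast
    have \<beta>P: "\<beta> \<le> P"
    proof -
      have "\<beta> \<le> (s ^ (n + 1) * x) * (1 + K') * x"
        unfolding \<beta>_def using \<alpha>E K' x by (intro mult_right_mono) auto
      thus ?thesis by (simp add: P_def power2_eq_square mult_ac)
    qed
    have \<alpha>P: "\<alpha> \<le> P"
    proof -
      have "s ^ (n + 1) * x \<le> (s ^ (n + 1) * (1 + K')) * x\<^sup>2"
        using sK x2 sn x by (intro mult_mono) auto
      thus ?thesis using \<alpha>E by (simp add: P_def)
    qed
    \<comment> \<open>Common majorant: \<open>P\<close> dominates \<open>A i\<close> and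
      \<open>B i\<close>, and \<open>1 + \<Gamma>\<close> covers \<open>C\<close> and its derivative
      in Cramer's rule, so \<open>2 * E\<^sup>2\<close> bounds both \<open>V\<close> and
      \<open>V * exp (k i)\<close>.\<close>
    define E where "E = P * (1 + \<Gamma>)"
    have PE: "P \<le> E" unfolding E_def using P1 \<Gamma>0 by (simp add: mult_le_cancel_left1)
    have E1: "E \<ge> 1" using PE P1 by simp
    have EE: "E \<le> E\<^sup>2" using E1 by (simp add: power2_eq_square mult_le_cancel_left1)
    have \<beta>0: "\<beta> \<ge> 0" using \<alpha>0 K' x by (simp add: \<beta>_def)
    have V: "norm (V z) \<le> 2 * E\<^sup>2" if z: "norm (z - p) \<le> r + e" for z
    proof -
      have "norm (z - p) \<le> r + 2 * e" using z e by simp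
      have "norm (V z) \<le> norm (B True z) * norm (A False z) + norm (A True z) * norm (B False z)"
        unfolding V_def norm_mult[symmetric] by (rule norm_triangle_ineq4)
      also have "\<dots> \<le> P * P + P * P"
        using A[OF \<open>norm (z - p) \<le> r + 2 * e\<close>] B[OF z] \<alpha>P \<beta>P P1
        by (intro add_mono mult_mono) (auto intro: order_trans)
      also have "\<dots> \<le> E * E + E * E" using PE P1 by (intro add_mono mult_mono) auto
      finally show ?thesis by (simp add: power2_eq_square)
    qed
    have Ve: "norm (V z * exp (k i z)) \<le> 2 * E\<^sup>2" if z: "norm (z - p) \<le> r + e" for z i
    proof -
      have z2: "norm (z - p) \<le> r + 2 * e" using z e by simp
      have prod: "norm (C z * B j z) \<le> \<Gamma> * P" "norm (deriv C z * A j z) \<le> \<Gamma> * P" for j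
        using \<Gamma>[OF z] A[OF z2, of j] B[OF z, of j] \<alpha>P \<beta>P \<Gamma>0 unfolding norm_mult
        by (auto intro!: mult_mono intro: order_trans)
      have "norm (deriv C z * A False z - C z * B False z) \<le> \<Gamma> * P + \<Gamma> * P"
        "norm (C z * B True z - deriv C z * A True z) \<le> \<Gamma> * P + \<Gamma> * P"
        by (intro order_trans[OF norm_triangle_ineq4] add_mono prod)+
      hence "norm (V z * exp (k i z)) \<le> \<Gamma> * P + \<Gamma> * P"
        using Cramer[of z] by (cases i) simp_all
      moreover have "\<Gamma> * P \<le> E" using P1 by (simp add: E_def algebra_simps)
      ultimately show ?thesis using EE by linarith
    qed
    have kb: "norm (k i z) \<le> norm (k i p) + 4 * x * (4 * ln E + c2)" if z: "norm (z - p) \<le> r" for i z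
    proof -
      have "norm (k i z) \<le> norm (k i p) + 2 * (r + e) / ((r + e) - r) *
          (2 * \<bar>ln (2 * E\<^sup>2)\<bar> + 2 + 2 * \<bar>ln (norm (V p))\<bar> + norm (k i p))"
        using V Ve e R by (intro exponent_bound_disc[OF hol_V hol_k Vp _ _ z]) auto
      moreover have "2 * (r + e) / ((r + e) - r) *
          (2 * \<bar>ln (2 * E\<^sup>2)\<bar> + 2 + 2 * \<bar>ln (norm (V p))\<bar> + norm (k i p)) \<le> 4 * x * (4 * ln E + c2)"
      proof (rule mult_mono)
        have "2 * (r + e) / ((r + e) - r) \<le> 2 * (2 * R) / (e)"
          using e r by (simp add: divide_right_mono)
        also have "\<dots> = 4 * x" using R by (simp add: x_def e_def)
        finally show "2 * (r + e) / ((r + e) - r) \<le> 4 * x" .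
        have "ln (2 * E\<^sup>2) = ln 2 + 2 * ln E" using E1 by (simp add: ln_mult ln_realpow)
        moreover have "ln E \<ge> 0" using E1 by simp
        moreover have "norm (k i p) \<le> \<kappa>" by (cases i) (auto simp: \<kappa>_def)
        ultimately show "2 * \<bar>ln (2 * E\<^sup>2)\<bar> + 2 + 2 * \<bar>ln (norm (V p))\<bar> + norm (k i p) \<le> 4 * ln E + c2"
          by (simp add: c2_def)
      qed (use x in auto)
      ultimately show ?thesis by linarith
    qed
    define L where "L = R + ln (2 + K')"
    have L: "L \<ge> 1" "R \<le> L" "ln (1 + K') \<le> L" 
    proof -
      have "0 \<le> ln (1 + K')" "ln (1 + K') \<le> ln (2 + K')" using K' by (auto intro: ln_mono)
      thus "L \<ge> 1" "R \<le> L" "ln (1 + K') \<le> L" using R unfolding L_def by linarith+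
    qed
    have Tx: "T \<ge> x" 
    proof -
      have "T \<ge> pi * (4 + 24 * x)" unfolding T_def using exp_ge_add_one_self[of "pi * (4 + 24 * x)"] by linarith
      moreover have "pi * (4 + 24 * x) \<ge> 1 * (4 + 24 * x)" using x pi_gt3 by (intro mult_right_mono) auto
      ultimately have "1 * (4 + 24 * x) \<le> T" by (rule order_trans[rotated])
      thus ?thesis using x by simp
    qed
    hence T1: "T \<ge> 1" using x by simp
    have TL: "T \<le> T * L" "L \<le> T * L" "1 \<le> T * L" using T1 L(1) mult_mono[of 1 T 1 L] by simp_all
    have "ln s \<le> c3 + ln (1 + K') + pi * T"
    proof -
      have "s \<le> (1 + norm w0 + c0) * (1 + K') * exp (pi * T)"
      proof -
        have "1 \<le> exp (pi * T)" using T1 by simp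
        hence "1 \<le> (1 + K') * exp (pi * T)" using K' by (intro mult_ge1_I) auto
        hence "(1 + norm w0) * 1 \<le> (1 + norm w0) * ((1 + K') * exp (pi * T))" by (intro mult_left_mono) auto
        thus ?thesis by (simp add: s_def S_def algebra_simps)
      qed
      hence "ln s \<le> ln ((1 + norm w0 + c0) * (1 + K') * exp (pi * T))" using s by (intro ln_mono) auto
      also have "\<dots> = c3 + ln (1 + K') + pi * T"
      proof -
        have "1 + norm w0 + c0 > 0" "1 + K' > 0" using c0(1) K' norm_ge_zero[of w0] by linarith+
        thus ?thesis by (simp add: c3_def ln_mult)
      qed
      finally show ?thesis .
    qed
    hence lns: "ln s \<le> (c3 + 1 + pi) * (T * L)"
    proof -
      have "c3 * 1 \<le> c3 * (T * L)" using c3 TL by (intro mult_left_mono)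
      moreover have "pi * T \<le> pi * (T * L)" using TL by (intro mult_left_mono) auto
      ultimately show ?thesis using \<open>ln s \<le> _\<close> L(3) TL(2) by (simp add: algebra_simps)
    qed
    have ln\<Gamma>: "ln (1 + \<Gamma>) \<le> (c4 + 2) * (T * L)"
    proof -
      have "1 + \<Gamma> \<le> (1 + \<gamma> * exp (norm p)) * exp (2 * R)"
        using R by (simp add: \<Gamma>_def exp_add algebra_simps)
      hence "ln (1 + \<Gamma>) \<le> ln ((1 + \<gamma> * exp (norm p)) * exp (2 * R))" using \<Gamma>0 by (intro ln_mono) auto
      also have "\<dots> = c4 + 2 * R" 
      proof -
        have "1 + \<gamma> * exp (norm p) > 0" using \<gamma> by (intro add_pos_nonneg) auto
        thus ?thesis by (simp add: c4_def ln_mult)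
      qed
      also have "\<dots> \<le> c4 * (T * L) + 2 * (T * L)"
        using L(2) TL c4 mult_left_mono[OF TL(3) c4] by (intro add_mono) auto
      finally show ?thesis by (simp add: algebra_simps)
    qed
    have "ln E = (real n + 1) * ln s + ln (1 + K') + 2 * ln x + ln (1 + \<Gamma>)"
    proof -
      have pos: "s ^ (n + 1) > 0" "1 + K' > 0" "x\<^sup>2 > 0" "1 + \<Gamma> > 0" using s K' x \<Gamma>0 by auto
      hence "ln E = ln (s ^ (n + 1)) + ln (1 + K') + ln (x\<^sup>2) + ln (1 + \<Gamma>)"
        unfolding E_def P_def by (subst ln_mult ln_mult_pos; simp)+
      also have "ln (s ^ (n + 1)) = (real n + 1) * ln s" using s by (simp only: ln_realpow) simp
      also have "ln (x\<^sup>2) = 2 * ln x" using x by (simp add: ln_realpow)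
      finally show ?thesis .
    qed
    also have "\<dots> \<le> (real n + 1) * ((c3 + 1 + pi) * (T * L)) + T * L + 2 * (T * L) + (c4 + 2) * (T * L)"
    proof (intro add_mono mult_left_mono lns ln\<Gamma>)
      show "ln (1 + K') \<le> T * L" using L(3) TL(2) by linarith
      show "ln x \<le> T * L" using ln_le_minus_one[of x] x Tx TL(1) by linarith
    qed auto
    also have "\<dots> = c5 * (T * L)" by (simp add: c5_def algebra_simps)
    finally have lnE: "ln E \<le> c5 * (T * L)" .
    have "K r \<le> (norm (k True p) + 4 * x * (4 * ln E + c2)) + (norm (k False p) + 4 * x * (4 * ln E + c2))"
      using R by (intro K_le[where b = "\<lambda>i. norm (k i p) + 4 * x * (4 * ln E + c2)"] kb) auto
    also have "\<dots> = \<kappa> + 8 * x * (4 * ln E + c2)" by (simp add: \<kappa>_def)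
    also have "\<dots> \<le> 2 * \<kappa> * (T * (T * L)) + 8 * T * (4 * (c5 * (T * L)) + c2 * (T * L))"
    proof (intro add_mono mult_mono)
      have TTL: "1 \<le> T * (T * L)" using T1 TL(3) by (rule mult_ge1_I)
      have "\<kappa> * 1 \<le> \<kappa> * (T * (T * L))" using TTL \<kappa> by (rule mult_left_mono)
      moreover have "0 \<le> \<kappa> * (T * (T * L))" using \<kappa> TTL by simp
      ultimately show "\<kappa> \<le> 2 * \<kappa> * (T * (T * L))" by simp
      show "c2 \<le> c2 * (T * L)" using mult_left_mono[OF TL(3) c2] by simp
    qed (use Tx x lnE E1 c2 T1 in auto)
    also have "\<dots> = c6 * T\<^sup>2 * L" by (simp add: c6_def power2_eq_square algebra_simps)
    also have "\<dots> \<le> exp ((c6 + 56 * pi) / \<eta>) * L"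
    proof (intro mult_right_mono)
      have "c6 \<le> exp (c6 * x)" using exp_ge_add_one_self[of "c6 * x"] mult_left_mono[OF x c6] by linarith
      moreover have "T\<^sup>2 \<le> exp (56 * pi * x)"
      proof -
        have "T\<^sup>2 = exp (8 * pi + 48 * pi * x)" 
          by (simp add: T_def exp_double[symmetric] algebra_simps)
        also have "\<dots> \<le> exp (56 * pi * x)" using mult_left_mono[OF x, of "8 * pi"] by simp
        finally show ?thesis .
      qed
      ultimately have "c6 * T\<^sup>2 \<le> exp (c6 * x) * exp (56 * pi * x)" by (intro mult_mono) auto
      also have "\<dots> = exp ((c6 + 56 * pi) / \<eta>)" by (simp add: x_def exp_add[symmetric] add_divide_distrib)
      finally show "c6 * T\<^sup>2 \<le> exp ((c6 + 56 * pi) / \<eta>)" .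
    qed (use L in simp)
    finally show "K r \<le> exp ((c6 + 56 * pi) / \<eta>) * (R + ln (2 + K (r + 4 * (\<eta> * R))))"
      by (simp add: L_def K'_def e_def)
  qed
qed

lemma linear_growth:
  assumes Vp: "V p \<noteq> 0"
  obtains c where "\<And>z. norm (M (g i z)) \<le> c * (1 + norm z)"
proof -
  obtain c0 where c0: "c0 \<ge> 1" and step: "\<And>r R \<eta>. 0 < \<eta> \<Longrightarrow> \<eta> \<le> 1 \<Longrightarrow> 1 \<le> R \<Longrightarrow> R \<le> r \<Longrightarrow> r + 4 * (\<eta> * R) \<le> 2 * R \<Longrightarrow>
     K r \<le> exp (c0 / \<eta>) * (R + ln (2 + K (r + 4 * (\<eta> * R))))"
    using growth_step[OF Vp] by metis
  define c where "c = 8 * c0"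
  have c: "c \<ge> 1" using c0 by (simp add: c_def)
  have KR: "K R \<le> exp c * (3 * R + 6 * c)" if R: "R \<ge> 1" for R
  proof -
    \<comment> \<open>Radii increasing from \<open>R\<close> towards \<open>2 * R\<close>. For
      \<open>\<eta> = 1 / (8 * 2 ^ j)\<close> the four strips fill exactly the gap from
      \<open>r j\<close> to \<open>r (Suc j)\<close>, and \<open>c0 / \<eta>\<close> becomes
      \<open>c * 2 ^ j\<close>.\<close>
    define r where "r j = R * (2 - 1 / 2 ^ j)" for j :: nat
    have r: "R \<le> r j" "r j \<le> 2 * R" "r j \<ge> 0" for j
    proof -
      have "(1::real) / 2 ^ j \<le> 1" by simp
      hence "R * 1 \<le> R * (2 - 1 / 2 ^ j)" using R by (intro mult_left_mono) auto
      thus "R \<le> r j" by (simp add: r_def)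
      thus "r j \<ge> 0" using R by simp
      show "r j \<le> 2 * R" using R by (simp add: r_def algebra_simps)
    qed
    have "K (r 0) \<le> exp c * (3 * R + 6 * c)"
    proof (rule bounded_iterated_log_bound[where b = "K (2 * R)"])
      fix j
      show "0 \<le> K (r j)" using r by (intro K_nonneg)
      show "K (r j) \<le> K (2 * R)" using r by (intro K_mono)
      have "r j + 4 * ((1 / (8 * 2 ^ j)) * R) = r (Suc j)" by (simp add: r_def field_simps)
      moreover have "(1::real) / (8 * 2 ^ j) \<le> 1" 
        using order_trans[of 1 "2 ^ j" "8 * 2 ^ j :: real"] by (simp add: divide_le_eq)
      ultimately show "K (r j) \<le> exp (c * 2 ^ j) * (R + ln (2 + K (r (Suc j))))"
        using step[of "1 / (8 * 2 ^ j)" R "r j"] r[of j] r[of "Suc j"] R by (simp add: c_def mult_ac)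
    qed (use c R in auto)
    thus ?thesis by (simp add: r_def)
  qed
  have "norm (M (g i z)) \<le> exp c * (3 + 3 * norm p + 6 * c) * (1 + norm z)" for z
  proof -
    have "norm (k i z) \<le> K (1 + norm (z - p))" by (rule k_le_K) simp
    also have "\<dots> \<le> exp c * (3 * (1 + norm (z - p)) + 6 * c)" by (rule KR) simp
    also have "\<dots> \<le> exp c * ((3 + 3 * norm p + 6 * c) * (1 + norm z))"
    proof (intro mult_left_mono)
      have "0 \<le> norm p * norm z" "0 \<le> c * norm z" using c by auto
      moreover have eq: "(3 + 3 * norm p + 6 * c) * (1 + norm z)
          = 3 + 3 * norm p + 6 * c + 3 * norm z + 3 * (norm p * norm z) + 6 * (c * norm z)"
        by (simp add: algebra_simps)
      ultimately show "3 * (1 + norm (z - p)) + 6 * c \<le> (3 + 3 * norm p + 6 * c) * (1 + norm z)"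
        using norm_triangle_ineq4[of z p] unfolding eq by (simp only: distrib_left)
    qed simp
    finally show ?thesis by (simp add: k_def mult.assoc)
  qed
  thus ?thesis using that by blast
qed

end

section \<open>Factorizations\<close>

text \<open>Picard's theorem at infinity: composition with \<open>exp (- i z)\<close>, of modulus
  \<open>exp (Im z)\<close>, makes the function periodic on a half plane, where growth exponential
  in \<open>Im z\<close> means polynomial growth in the original variable.\<close>

lemma transcendental_infinite_fibres:
  assumes g: "g holomorphic_on UNIV" and np: "\<not> (\<exists>p. \<forall>z. g z = poly p z)" and "w1 \<noteq> w2"
  shows "infinite {z. g z = w1 \<or> g z = w2}"
proof
  assume "finite {z. g z = w1 \<or> g z = w2}"
  hence "bounded {z. g z = w1 \<or> g z = w2}" by (rule finite_imp_bounded)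
  then obtain R where R: "\<And>z. g z = w1 \<or> g z = w2 \<Longrightarrow> norm z \<le> R"
    unfolding bounded_iff by blast
  define q where "q z = g (exp (-\<i> * z))" for z
  define Y where "Y = ln (max R 1)"
  have "\<exists>B Y1 N. \<forall>z. Im z > Y1 \<longrightarrow> norm (q z) \<le> B * exp (real N * Im z)"
  proof (rule periodic_halfplane_Picard_growth)
    have "(\<lambda>z. exp (-\<i> * z)) holomorphic_on UNIV" by (intro holomorphic_intros)
    from holomorphic_on_compose_gen[OF this g] have "q holomorphic_on UNIV" by (simp add: q_def[abs_def] o_def)
    thus "q holomorphic_on {z. Im z > Y}" by (rule holomorphic_on_subset) simp
    show "q (z + of_real (2 * pi)) = q z" for z
    proof -
      have "-\<i> * (z + of_real (2 * pi)) = -\<i> * z + - (2 * of_real pi * \<i>)"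
        by (simp add: algebra_simps)
      hence "exp (-\<i> * (z + of_real (2 * pi))) = exp (-\<i> * z)"
        by (simp only: exp_add exp_minus exp_two_pi_i) simp
      thus ?thesis by (simp add: q_def)
    qed
    show "q z \<noteq> w1 \<and> q z \<noteq> w2" if "Im z > Y" for z
    proof -
      have "exp (Im z) > exp Y" using that by simp
      hence "norm (exp (-\<i> * z)) > R" by (simp add: Y_def)
      thus ?thesis using R[of "exp (-\<i> * z)"] unfolding q_def by force
    qed
  qed (use \<open>w1 \<noteq> w2\<close> in auto)
  then obtain B Y1 N where B: "\<And>z. Im z > Y1 \<Longrightarrow> norm (q z) \<le> B * exp (real N * Im z)" by blast
  have "norm (g w) \<le> B * norm w ^ N" if w: "exp Y1 + 1 \<le> norm w" for w
  proof -
    have n: "norm w > exp Y1" "norm w > 0" using w exp_gt_zero[of Y1] by linarith+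
    define z where "z = \<i> * Ln w"
    have "-\<i> * z = Ln w" by (simp add: z_def)
    hence zw: "exp (-\<i> * z) = w" using n(2) by simp
    have Im: "Im z = ln (norm w)" using n(2) by (simp add: z_def)
    have "exp Y1 < exp (ln (norm w))" using n by simp
    hence "Im z > Y1" unfolding Im by (simp only: exp_less_cancel_iff)
    hence "norm (q z) \<le> B * exp (real N * Im z)" by (rule B)
    also have "exp (real N * Im z) = norm w ^ N" unfolding Im exp_of_nat_mult using n(2) by simp
    finally show ?thesis unfolding q_def zw .
  qed
  then obtain p where "\<And>z. g z = poly p z" using polynomial_growth_imp_poly[OF g] by metis
  thus False using np by blast
qed

text \<open>Vieta: the coefficient below the leading one is minus the sum of the roots. Splitting
  off one root at a time accounts for multiplicities.\<close>

lemma monic_roots_on_line: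
  fixes P :: "complex poly"
  assumes "lead_coeff P = 1" "degree P = Suc n" "\<And>z. poly P z = 0 \<Longrightarrow> Im z = \<eta>"
  shows "Im (coeff P n) = - real (Suc n) * \<eta>"
  using assms
proof (induction n arbitrary: P)
  case (0 P)
  define c where "c = coeff P 0"
  have "P = [:c, 1:]"
    using 0 by (intro poly_eqI) (auto simp: c_def coeff_pCons coeff_eq_0 split: nat.splits)
  hence "poly P (- c) = 0" by simp
  hence "Im (- c) = \<eta>" by (rule 0(3))
  thus ?case by (simp add: c_def)
next
  case (Suc n P)
  have "\<not> constant (poly P)" using Suc.prems(2) by (simp add: constant_degree)
  then obtain r where r: "poly P r = 0" using fundamental_theorem_of_algebra by blast
  hence "[:-r, 1:] dvd P" by (simp only: poly_eq_0_iff_dvd)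
  then obtain Q where Q: "P = [:-r, 1:] * Q" by (rule dvdE)
  have Q0: "Q \<noteq> 0" using Suc.prems(2) Q by auto
  have dQ: "degree Q = Suc n" using Suc.prems(2) Q0 unfolding Q by (subst (asm) degree_mult_eq) auto
  have lQ: "lead_coeff Q = 1" using Suc.prems(1) unfolding Q lead_coeff_mult by simp
  have "Im (coeff Q n) = - real (Suc n) * \<eta>"
    using Suc.prems(3) Q by (intro Suc.IH lQ dQ) auto
  moreover have "coeff Q (Suc n) = 1" using lQ dQ by simp
  hence "coeff P (Suc n) = coeff Q n - r" unfolding Q by simp
  moreover have "Im r = \<eta>" using Suc.prems(3) r .
  ultimately show ?case by (simp only: minus_complex.sel) (simp add: algebra_simps)
qed

lemma entire_zero_free_imp_exp:
  assumes "W holomorphic_on UNIV" "\<And>z. W z \<noteq> 0"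
  obtains M where "M holomorphic_on UNIV" "\<And>z. W z = exp (M z)"
  by (rule contractible_imp_holomorphic_log[OF assms(1) contractible_UNIV]) (use assms(2) that in auto)

lemma norm_sin_cos_le_exp_norm: "norm (sin z) \<le> exp (norm z)" "norm (cos z) \<le> exp (norm z)" for z :: complex
proof -
  have "norm (sin z) \<le> exp \<bar>Im z\<bar> \<and> norm (cos z) \<le> exp \<bar>Im z\<bar>"
  proof (cases "Im z \<ge> 0")
    case True thus ?thesis using norm_sin_cos_le_exp[of z] by simp
  next
    case False thus ?thesis using norm_sin_cos_le_exp[of "-z"] by simp
  qed
  moreover have "exp \<bar>Im z\<bar> \<le> exp (norm z)" using abs_Im_le_cmod by simp
  ultimately show "norm (sin z) \<le> exp (norm z)" "norm (cos z) \<le> exp (norm z)" by linarith+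
qed

section \<open>Factorizations \<open>F = f \<circ> g\<close> for a nonexceptional parameter\<close>

locale factorized_sin_composite = sin_composite +
  fixes f g :: "complex \<Rightarrow> complex"
  assumes distinct_critical_values: "F p = F q \<Longrightarrow> deriv F p = 0 \<Longrightarrow> deriv F q = 0 \<Longrightarrow>
      \<exists>k :: int. q = p + of_int k * (2 * of_real pi)"
    and hol_f: "f holomorphic_on UNIV" and hol_g: "g holomorphic_on UNIV"
    and F_eq: "F z = f (g z)"
begin

lemma F_nonconstant: "\<exists>z. F z \<noteq> c"
proof -
  obtain z where "F z = c + 1" using F_attains_value by blast
  thus ?thesis by (intro exI[of _ z]) simp
qed

lemma deriv_F: "deriv F z = deriv f (g z) * deriv g z"
proof -
  have "((\<lambda>z. f (g z)) has_field_derivative deriv f (g z) * deriv g z) (at z)"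
    by (rule DERIV_chain2) (auto intro: holomorphic_derivI hol_f hol_g)
  moreover have "(\<lambda>z. f (g z)) = F" using F_eq by auto
  ultimately show ?thesis using DERIV_imp_deriv by auto
qed

lemma critical_Im: "F p = F q \<Longrightarrow> deriv F p = 0 \<Longrightarrow> deriv F q = 0 \<Longrightarrow> Im p = Im q"
  using distinct_critical_values[of p q] by auto

lemma critical_fibre:
  assumes "deriv f w = 0" "g p = w" "g q = w"
  shows "\<exists>k :: int. q = p + of_int k * (2 * of_real pi)"
  using assms by (intro distinct_critical_values) (simp_all add: F_eq deriv_F)

lemma critical_fibre_Im: "deriv f w = 0 \<Longrightarrow> g p = w \<Longrightarrow> g q = w \<Longrightarrow> Im p = Im q"
  using critical_fibre[of w p q] by auto

lemma f_nonconstant: "\<not> f constant_on UNIV"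
proof
  assume "f constant_on UNIV"
  then obtain c where "\<And>w. f w = c" unfolding constant_on_def by auto
  thus False using F_nonconstant[of c] F_eq by simp
qed

text \<open>Suppose the degree is at least 2. A critical point of \<open>F\<close> can be moved by
  periods off the finitely many zeros of \<open>g'\<close>, and then maps to a zero \<open>w\<close>
  of \<open>deriv f\<close>. Subtracting \<open>w\<close> does not touch the coefficient below the
  leading one, so the height \<open>\<eta>\<close> read off from it is the same for all critical
  points, contrary to \<open>F_critical_points\<close>.\<close>

lemma polynomial_inner_factor_linear:
  assumes G: "\<And>z. g z = poly G z"
  shows "linear_fun g"
proof -
  have d0: "degree G \<noteq> 0"
  proof
    assume "degree G = 0"
    then obtain c where "G = [:c:]" by (rule degree_eq_zeroE)
    thus False using F_nonconstant[of "f c"] F_eq G by simp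
  qed
  show ?thesis
  proof (cases "degree G = 1")
    case True
    define b c where "b = coeff G 0" and "c = coeff G 1"
    have "G = [:b, c:]" using True
      by (intro poly_eqI) (auto simp: coeff_pCons coeff_eq_0 b_def c_def split: nat.splits)
    moreover have "c \<noteq> 0" using True by (metis c_def leading_coeff_0_iff degree_0 zero_neq_one)
    ultimately show ?thesis unfolding linear_fun_def G by (intro exI[of _ c] exI[of _ b]) (simp add: algebra_simps)
  next
    case False
    with d0 obtain n where n: "degree G = Suc (Suc n)" by (metis One_nat_def not0_implies_Suc)
    define \<eta> where "\<eta> = - Im (coeff G (Suc n) / lead_coeff G) / real (Suc (Suc n))"
    have G0: "G \<noteq> 0" using n by auto
    hence lc: "coeff G (Suc (Suc n)) \<noteq> 0" using n by (metis leading_coeff_0_iff)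
    have "Im z = \<eta>" if z: "deriv F z = 0" for z
    proof -
      have "finite {u. poly (pderiv G) u = 0}"
        using n by (intro poly_roots_finite) (auto simp: pderiv_eq_0_iff)
      moreover have "infinite (range (\<lambda>k::int. z + of_int k * (2 * of_real pi)))"
        by (subst finite_image_iff) (auto simp: inj_on_def infinite_UNIV_int)
      ultimately obtain k :: int where k: "poly (pderiv G) (z + of_int k * (2 * of_real pi)) \<noteq> 0"
        by (smt (verit, best) finite_subset image_subset_iff mem_Collect_eq rangeE subsetI)
      define z' where "z' = z + of_int k * (2 * of_real pi)"
      define w where "w = g z'"
      have "deriv g z' = poly (pderiv G) z'"
        using DERIV_imp_deriv[OF poly_DERIV[of G z']] G by (simp add: ext[of g "poly G"])
      moreover have "deriv F z' = 0" unfolding z'_def deriv_F_periodic_int by (rule z)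
      ultimately have fw: "deriv f w = 0" using k by (simp add: deriv_F w_def z'_def)
      define P where "P = smult (1 / lead_coeff G) (G - [:w:])"
      have dG: "degree (G - [:w:]) = Suc (Suc n)" 
        using degree_add_eq_left[of "-[:w:]" G] n unfolding diff_conv_add_uminus[symmetric] by simp
      have "Im (coeff P (Suc n)) = - real (Suc (Suc n)) * Im z"
      proof (rule monic_roots_on_line)
        show "degree P = Suc (Suc n)" using G0 dG by (simp add: P_def)
        thus "lead_coeff P = 1" using lc n by (simp add: P_def)
        show "Im u = Im z" if "poly P u = 0" for u
        proof -
          have "g u = w" using that G0 G by (simp add: P_def)
          hence "Im z' = Im u" using critical_fibre_Im[OF fw, of z' u] by (simp add: w_def)
          thus ?thesis by (simp add: z'_def)
        qed
      qed
      moreover have "coeff P (Suc n) = coeff G (Suc n) / lead_coeff G" by (simp add: P_def)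
      ultimately show "Im z = \<eta>" unfolding \<eta>_def by (simp add: field_simps)
    qed
    thus ?thesis using F_critical_points[of "\<bar>\<eta>\<bar>"] by force
  qed
qed

lemma periodic_imp_false:
  assumes per: "\<And>z. g (z + of_real P) = g z" and P: "P > 0"
    and w: "w1 \<noteq> w2" "deriv f w1 = 0" "deriv f w2 = 0"
  shows False
proof -
  \<comment> \<open>A fibre over a zero of \<open>deriv f\<close> lies on one horizontal line, so
    far from the real axis \<open>g\<close> omits both \<open>w1\<close> and
    \<open>w2\<close>.\<close>
  have "\<exists>Y. \<forall>z. g z = w \<longrightarrow> \<bar>Im z\<bar> \<le> Y" if "deriv f w = 0" for w
  proof (cases "\<exists>z. g z = w")
    case True
    then obtain z0 where "g z0 = w" by blast
    thus ?thesis using critical_fibre_Im[OF that, of z0] by (intro exI[of _ "\<bar>Im z0\<bar>"]) auto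
  qed auto
  then obtain Y1 Y2 where Y: "\<And>z. g z = w1 \<Longrightarrow> \<bar>Im z\<bar> \<le> Y1" "\<And>z. g z = w2 \<Longrightarrow> \<bar>Im z\<bar> \<le> Y2"
    using w by metis
  define Y where "Y = max Y1 Y2"
  \<comment> \<open>The signs \<open>\<sigma> = 1\<close> and \<open>\<sigma> = -1\<close> treat
    both ends of the cylinder alike: \<open>q \<sigma>\<close> turns the chosen end into the upper
    one.\<close>
  define q where "q \<sigma> z = g (of_real \<sigma> * z)" for \<sigma> :: real and z
  have holq: "q \<sigma> holomorphic_on UNIV" for \<sigma>
    using holomorphic_on_affine[OF hol_g, of 0 "of_real \<sigma>"] by (simp add: q_def[abs_def])
  have perq: "q \<sigma> (z + of_real P) = q \<sigma> z" if "\<bar>\<sigma>\<bar> = 1" for \<sigma> z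
    using that per[of z] per[of "-z - of_real P"] by (auto simp: q_def abs_if split: if_splits)
  have pole: "(\<forall>Y'. \<exists>W. \<forall>w. norm w > W \<longrightarrow> (\<exists>z. Im z > Y' \<and> q \<sigma> z = w)) \<and>
      (\<forall>W. \<exists>Y1. \<forall>z. Im z > Y1 \<longrightarrow> norm (q \<sigma> z) > W) \<and>
      (\<exists>Y1. \<forall>z. Im z > Y1 \<longrightarrow> deriv (q \<sigma>) z \<noteq> 0)" if \<sigma>: "\<bar>\<sigma>\<bar> = 1" for \<sigma>
  proof (rule periodic_halfplane_Picard[of "q \<sigma>" Y P w1 w2, THEN disjE])
    show "q \<sigma> holomorphic_on {z. Im z > Y}" using holq by (rule holomorphic_on_subset) simp
    show "q \<sigma> z \<noteq> w1 \<and> q \<sigma> z \<noteq> w2" if "Im z > Y" for z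
      using Y(1)[of "of_real \<sigma> * z"] Y(2)[of "of_real \<sigma> * z"] that \<sigma> 
      by (auto simp: q_def Y_def abs_mult)
    \<comment> \<open>A bounded end is impossible, since \<open>F = f \<circ> g\<close> would then
      be bounded on a half plane.\<close>
    show ?thesis if b: "\<exists>B Y1. \<forall>z. Im z > Y1 \<longrightarrow> norm (q \<sigma> z) \<le> B"
    proof -
      obtain B Y1 where B: "\<And>z. Im z > Y1 \<Longrightarrow> norm (q \<sigma> z) \<le> B" using b by blast
      have "continuous_on (cball 0 B) f"
        using holomorphic_on_imp_continuous_on[OF hol_f] by (rule continuous_on_subset) simp
      hence "bounded (f ` cball 0 B)" by (intro compact_imp_bounded compact_continuous_image) auto
      then obtain B' where "\<forall>y\<in>f ` cball 0 B. norm y \<le> B'"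
        unfolding bounded_iff by blast
      hence B': "\<And>w. norm w \<le> B \<Longrightarrow> norm (f w) \<le> B'" by simp
      have bd: "norm (F (of_real \<sigma> * z)) \<le> B'" if "Im z > Y1" for z
        using B[OF that] B' by (simp add: F_eq q_def)
      have False
      proof (cases "\<sigma> = 1")
        case True
        show False by (rule not_exp_bounded_upper[of Y1 B' 0]) (use bd True in auto)
      next
        case False
        hence "\<sigma> = -1" using \<sigma> by linarith
        hence "norm (F z) \<le> B'" if "Im z < - Y1" for z using bd[of "-z"] that by simp
        thus False by (intro not_exp_bounded_lower[of Y1 B' 0]) auto
      qed
      thus ?thesis ..
    qed
  qed (use perq \<sigma> P w(1) in auto)
  have surj: "\<exists>W. \<forall>w. norm w > W \<longrightarrow> (\<exists>z. \<sigma> * Im z > 0 \<and> g z = w)" if \<sigma>: "\<bar>\<sigma>\<bar> = 1" for \<sigma> :: real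
  proof -
    obtain W where W: "\<And>w. norm w > W \<Longrightarrow> \<exists>z. Im z > 0 \<and> q \<sigma> z = w" using pole[OF \<sigma>] by metis
    have "\<exists>z. \<sigma> * Im z > 0 \<and> g z = w" if w: "norm w > W" for w
    proof -
      obtain z where z: "Im z > 0" "q \<sigma> z = w" using W[OF w] by blast
      have "\<sigma> * \<sigma> = 1" using \<sigma> by (metis abs_mult_self_eq mult_1)
      hence "\<sigma> * Im (of_real \<sigma> * z) = Im z" by (simp flip: mult.assoc)
      hence "\<sigma> * Im (of_real \<sigma> * z) > 0" using z(1) by (rule ssubst)
      thus ?thesis using z(2) unfolding q_def by blast
    qed
    thus ?thesis by blast
  qed
  have s2: "\<sigma> * \<sigma> = 1" if "\<bar>\<sigma>\<bar> = 1" for \<sigma> :: real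
    using that by (metis abs_mult_self_eq mult_1)
  have qq: "q \<sigma> (of_real \<sigma> * z) = g z" if "\<bar>\<sigma>\<bar> = 1" for \<sigma> z
    using s2[OF that] by (simp add: q_def flip: mult.assoc of_real_mult)
  have grow: "\<exists>Y. \<forall>z. \<sigma> * Im z > Y \<longrightarrow> norm (g z) > W" if \<sigma>: "\<bar>\<sigma>\<bar> = 1" for \<sigma> W :: real
  proof -
    obtain Y where Y: "\<And>z. Im z > Y \<Longrightarrow> norm (q \<sigma> z) > W" using pole[OF \<sigma>] by metis
    have "norm (g z) > W" if "\<sigma> * Im z > Y" for z
      using Y[of "of_real \<sigma> * z"] that qq[OF \<sigma>] by simp
    thus ?thesis by blast
  qed
  have crit: "\<exists>Y. \<forall>z. \<sigma> * Im z > Y \<longrightarrow> deriv g z \<noteq> 0" if \<sigma>: "\<bar>\<sigma>\<bar> = 1" for \<sigma> :: real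
  proof -
    obtain Y where Y: "\<And>z. Im z > Y \<Longrightarrow> deriv (q \<sigma>) z \<noteq> 0" using pole[OF \<sigma>] by metis
    have "(q \<sigma> has_field_derivative deriv g (of_real \<sigma> * z) * of_real \<sigma>) (at z)" for z
      unfolding q_def
      by (rule DERIV_chain2[where g = "\<lambda>z. of_real \<sigma> * z"])
         (auto intro!: derivative_eq_intros holomorphic_derivI[OF hol_g open_UNIV])
    hence "deriv (q \<sigma>) z = deriv g (of_real \<sigma> * z) * of_real \<sigma>" for z
      using DERIV_imp_deriv by blast
    hence "deriv g z \<noteq> 0" if "\<sigma> * Im z > Y" for z
      using Y[of "of_real \<sigma> * z"] that s2[OF \<sigma>] by (auto simp flip: mult.assoc of_real_mult)
    thus ?thesis by blast
  qed
  \<comment> \<open>Close enough to its pole \<open>g\<close> has no critical points, so a critical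
    point of \<open>F\<close> there forces \<open>deriv f (g z) = 0\<close>, and
    \<open>critical_fibre_Im\<close> applies to the preimage at the opposite end.\<close>
  have no_crit: "\<exists>Y. \<forall>z. \<sigma> * Im z > Y \<longrightarrow> deriv F z \<noteq> 0" if \<sigma>: "\<bar>\<sigma>\<bar> = 1" for \<sigma> :: real
  proof -
    have "\<bar>-\<sigma>\<bar> = 1" using \<sigma> by simp
    from surj[OF this] obtain W where W: "\<And>w. norm w > W \<Longrightarrow> \<exists>z. -\<sigma> * Im z > 0 \<and> g z = w" by blast
    obtain Y1 where Y1: "\<And>z. \<sigma> * Im z > Y1 \<Longrightarrow> norm (g z) > W" using grow[OF \<sigma>] by blast
    obtain Y2 where Y2: "\<And>z. \<sigma> * Im z > Y2 \<Longrightarrow> deriv g z \<noteq> 0" using crit[OF \<sigma>] by blast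
    have "deriv F z \<noteq> 0" if z: "\<sigma> * Im z > max (max Y1 Y2) 0" for z
    proof
      assume "deriv F z = 0"
      hence "deriv f (g z) = 0" using Y2[of z] z by (simp add: deriv_F)
      moreover obtain z' where "-\<sigma> * Im z' > 0" "g z' = g z" using W[OF Y1[of z]] z by auto
      ultimately have "Im z' = Im z" using critical_fibre_Im[of "g z" z' z] by blast
      thus False using \<open>-\<sigma> * Im z' > 0\<close> z by simp
    qed
    thus ?thesis by blast
  qed
  obtain Ya where Ya: "\<And>z. Im z > Ya \<Longrightarrow> deriv F z \<noteq> 0" using no_crit[of 1] by auto
  obtain Yb where Yb: "\<And>z. - Im z > Yb \<Longrightarrow> deriv F z \<noteq> 0" using no_crit[of "-1"] by auto
  obtain z where "\<bar>Im z\<bar> > max Ya Yb" "deriv F z = 0" using F_critical_points by blast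
  thus False using Ya[of z] Yb[of z] by (auto simp: abs_if split: if_splits)
qed

text \<open>Near \<open>z1\<close> the translates \<open>z \<mapsto> g (z + 2 \<pi> k)\<close> all solve \<open>f (u z) = F z\<close>, so they omit
  two common values; those taking the value \<open>w1\<close> at \<open>z1\<close> are uniformly bounded by Schottky's theorem,
  hence at each point only finitely many values occur, and two of the translates must coincide.\<close>
lemma infinite_critical_fibre_imp_periodic:
  assumes w1: "deriv f w1 = 0" and inf: "infinite {z. g z = w1}"
  obtains P where "P > 0" "\<And>z. g (z + of_real P) = g z"
proof -
  define T where "T k = of_int k * (2 * of_real pi :: complex)" for k :: int
  obtain z1 where z1: "g z1 = w1" using inf not_finite_existsD by blast
  define S where "S = {k. g (z1 + T k) = w1}"
  have "{z. g z = w1} \<subseteq> (\<lambda>k. z1 + T k) ` S"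
  proof
    fix z assume "z \<in> {z. g z = w1}"
    moreover from this obtain k where "z = z1 + T k" using critical_fibre[OF w1 z1, of z] by (auto simp: T_def)
    ultimately show "z \<in> (\<lambda>k. z1 + T k) ` S" by (auto simp: S_def)
  qed
  hence infS: "infinite S" using inf finite_surj by blast
  have fT: "f (g (z + T k)) = F z" for z k
    using F_periodic_int[of z k] by (simp add: F_eq[symmetric] T_def)
  obtain \<delta> where \<delta>: "\<delta> > 0" "\<And>z. norm (z - z1) \<le> \<delta> \<Longrightarrow> norm (F z - F z1) < 1"
  proof -
    have "isCont F z1"
      using holomorphic_on_imp_continuous_on[OF holomorphic_F, of UNIV] continuous_on_eq_continuous_at open_UNIV by blast
    then obtain d where "d > 0" "\<And>z. dist z z1 < d \<Longrightarrow> dist (F z) (F z1) < 1"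
      unfolding continuous_at_eps_delta by (metis zero_less_one)
    thus ?thesis by (intro that[of "d/2"]) (auto simp: dist_norm)
  qed
  \<comment> \<open>By Liouville \<open>f\<close> cannot stay within distance 1 of
    \<open>F z1\<close> off a single point. On the disc of radius \<open>\<delta>\<close> every
    translate of \<open>g\<close> omits \<open>u1\<close> and \<open>u2\<close>, because
    \<open>f\<close> of the translate is \<open>F\<close>, which stays within that distance.\<close>
  obtain u1 u2 where u: "u1 \<noteq> u2" "norm (f u1 - F z1) \<ge> 1" "norm (f u2 - F z1) \<ge> 1"
  proof (rule ccontr)
    assume no: "\<not> thesis"
    have "\<exists>u0. \<forall>u. u \<noteq> u0 \<longrightarrow> norm (f u - F z1) < 1"
      using no that by (metis linorder_not_less)
    then obtain u0 where u0: "\<And>u. u \<noteq> u0 \<Longrightarrow> norm (f u - F z1) < 1" by blast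
    have "norm (f u) \<le> norm (F z1) + 1 + norm (f u0)" for u
    proof (cases "u = u0")
      case True
      thus ?thesis using norm_ge_zero[of "F z1"] by simp
    next
      case False
      from u0[OF this] show ?thesis
        using norm_triangle_sub[of "f u" "F z1"] norm_ge_zero[of "f u0"] by linarith
    qed
    hence "bounded (range f)" unfolding bounded_iff by blast
    thus False using Liouville_theorem[OF hol_f] f_nonconstant by blast
  qed
  have une: "u2 - u1 \<noteq> 0" using u(1) by simp
  define \<rho> where "\<rho> = norm ((w1 - u1) / (u2 - u1))"
  define X where "X = exp (pi * exp (pi * (2 + 2 * \<rho> + 12 * (1/2) / (1 - 1/2))))"
  define B where "B = norm u1 + norm (u2 - u1) * X"
  have bd: "norm (g (z + T k)) \<le> B" if k: "k \<in> S" and z: "norm (z - z1) \<le> \<delta> / 2" for z k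
  proof -
    define v where "v = (z - z1) / \<delta>"
    have zv: "z1 + T k + of_real \<delta> * v = z + T k" using \<delta>(1) by (simp add: v_def)
    define \<phi> where "\<phi> v = (g (z1 + T k + of_real \<delta> * v) - u1) / (u2 - u1)" for v
    have "norm (\<phi> v) \<le> X" unfolding X_def
    proof (rule Schottky[of \<phi> \<rho> "1/2" v])
      have "\<phi> holomorphic_on UNIV" unfolding \<phi>_def
        using holomorphic_on_affine[OF hol_g, of "z1 + T k" "of_real \<delta>"] une by (intro holomorphic_intros) auto
      thus "\<phi> holomorphic_on cball 0 1" by (rule holomorphic_on_subset) simp
      show "norm (\<phi> 0) \<le> \<rho>" using k by (simp add: \<phi>_def \<rho>_def S_def)
      show "\<not> (\<phi> y = 0 \<or> \<phi> y = 1)" if "y \<in> cball 0 1" for y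
      proof -
        have "norm (z1 + of_real \<delta> * y - z1) \<le> \<delta>" using that \<delta>(1) by (simp add: norm_mult mult_le_cancel_left1)
        hence "norm (F (z1 + of_real \<delta> * y) - F z1) < 1" by (rule \<delta>(2))
        moreover have "f (g (z1 + T k + of_real \<delta> * y)) = F (z1 + of_real \<delta> * y)"
          using fT[of "z1 + of_real \<delta> * y" k] by (simp add: algebra_simps)
        ultimately have "g (z1 + T k + of_real \<delta> * y) \<noteq> u1" "g (z1 + T k + of_real \<delta> * y) \<noteq> u2" using u by force+
        thus ?thesis using une by (auto simp: \<phi>_def)
      qed
      show "norm v \<le> 1/2" using z \<delta>(1) by (simp add: v_def norm_divide field_simps)
    qed auto
    moreover have "g (z + T k) - u1 = (u2 - u1) * \<phi> v" using une by (simp add: \<phi>_def zv)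
    hence "norm (g (z + T k) - u1) = norm (u2 - u1) * norm (\<phi> v)" by (simp add: norm_mult)
    ultimately have "norm (g (z + T k) - u1) \<le> norm (u2 - u1) * X" by (simp add: mult_left_mono)
    thus ?thesis using norm_triangle_sub[of "g (z + T k)" u1] by (simp add: B_def)
  qed
  define D where "D = ball z1 (\<delta> / 2)"
  have "\<exists>k\<in>S. \<exists>l\<in>S. k \<noteq> l \<and> g (z + T k) = g (z + T l)" if z: "z \<in> D" for z
  proof -
    have "norm (z - z1) \<le> \<delta> / 2" using z by (simp add: D_def dist_norm norm_minus_commute)
    hence "(\<lambda>k. g (z + T k)) ` S \<subseteq> {w \<in> cball 0 B. f w - F z = 0}" using bd fT by auto
    moreover have "finite {w \<in> cball 0 B. f w - F z = 0}"
    proof (rule holomorphic_compact_finite_zeros)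
      show "(\<lambda>w. f w - F z) holomorphic_on UNIV" by (intro holomorphic_intros hol_f)
      show "\<not> (\<lambda>w. f w - F z) constant_on UNIV" 
        using f_nonconstant unfolding constant_on_def by (metis diff_add_cancel)
    qed auto
    ultimately have "finite ((\<lambda>k. g (z + T k)) ` S)" by (rule finite_subset)
    hence "\<not> inj_on (\<lambda>k. g (z + T k)) S" using infS finite_imageD by blast
    thus ?thesis by (auto simp: inj_on_def)
  qed
  hence sub: "D \<subseteq> (\<Union>k. \<Union>l\<in>{l. k \<noteq> l}. {z. g (z + T k) = g (z + T l)})" by blast
  \<comment> \<open>Countably many coincidence sets cover a disc, so one of them is uncountable, and
    the identity theorem makes the two translates equal everywhere.\<close>
  have "\<exists>k l. k \<noteq> l \<and> uncountable {z. g (z + T k) = g (z + T l)}"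
  proof (rule ccontr)
    assume "\<not> ?thesis"
    hence "countable (\<Union>k. \<Union>l\<in>{l. k \<noteq> l}. {z. g (z + T k) = g (z + T l)})"
      by (intro countable_UN) auto
    hence "countable D" by (rule countable_subset[OF sub])
    moreover have "uncountable D" unfolding D_def using \<delta>(1) by (intro uncountable_ball) auto
    ultimately show False by simp
  qed
  then obtain k l where kl: "k \<noteq> l" "uncountable {z. g (z + T k) = g (z + T l)}" by blast
  have "(\<lambda>z. g (z + T k)) = (\<lambda>z. g (z + T l))"
  proof (rule holomorphic_countable_equal_UNIV[OF _ _ kl(2)])
    show "(\<lambda>z. g (z + T k)) holomorphic_on UNIV" "(\<lambda>z. g (z + T l)) holomorphic_on UNIV"
      using holomorphic_on_affine[OF hol_g, of "T k" 1] holomorphic_on_affine[OF hol_g, of "T l" 1] by (simp_all add: add.commute)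
  qed
  hence eq: "g (z + T k) = g (z + T l)" for z by meson
  have shift: "g (z + T j) = g z" if "j = k - l \<or> j = l - k" for j z
    using that eq[of "z - T l"] eq[of "z - T k"] by (auto simp: T_def algebra_simps)
  show ?thesis
  proof (rule that[of "2 * pi * of_int \<bar>k - l\<bar>"])
    show "2 * pi * of_int \<bar>k - l\<bar> > 0" using kl(1) by simp
    show "g (z + of_real (2 * pi * of_int \<bar>k - l\<bar>)) = g z" for z
      using shift[of "\<bar>k - l\<bar>" z] by (simp add: T_def mult_ac abs_if)
  qed
qed

lemma two_critical_points_imp_false:
  assumes "w1 \<noteq> w2" "deriv f w1 = 0" "deriv f w2 = 0" and "\<not> (\<exists>p. \<forall>z. g z = poly p z)"
  shows False
proof -
  have "infinite {z. g z = w1 \<or> g z = w2}"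
    using transcendental_infinite_fibres[OF hol_g assms(4,1)] .
  hence "infinite {z. g z = w1} \<or> infinite {z. g z = w2}" by (simp add: Collect_disj_eq)
  then obtain P where "P > 0" "\<And>z. g (z + of_real P) = g z"
    using infinite_critical_fibre_imp_periodic assms(2,3) by metis
  thus False using periodic_imp_false assms(1-3) by blast
qed

lemma power_exp_derivative_imp_false:
  assumes M: "M holomorphic_on UNIV" "\<not> M constant_on UNIV"
    and f': "\<And>w. deriv f w = (w - w0) ^ n * exp (M w)"
    and tr: "\<not> (\<exists>p. \<forall>z. g z = poly p z)"
  shows False
proof -
  define G where "G i z = (if i then g z else g (of_real pi - z))" for i z
  have holG: "G i holomorphic_on UNIV" for i
    using hol_g holomorphic_on_affine[OF hol_g, of "of_real pi" "-1"] by (cases i) (simp_all add: G_def[abs_def])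
  define C where "C z = 2 * a * cos z" for z
  have dC: "deriv C z = - (2 * a * sin z)" for z
    unfolding C_def by (rule DERIV_imp_deriv) (auto intro!: derivative_eq_intros)
  have dG: "deriv (G True) z = deriv g z" "deriv (G False) z = - deriv g (of_real pi - z)" for z
  proof -
    have "((\<lambda>z. g (of_real pi - z)) has_field_derivative deriv g (of_real pi - z) * (-1)) (at z)"
      by (rule DERIV_chain2[where g = "\<lambda>z. of_real pi - z"])
         (auto intro!: derivative_eq_intros holomorphic_derivI[OF hol_g open_UNIV])
    thus "deriv (G False) z = - deriv g (of_real pi - z)" by (simp add: G_def[abs_def] DERIV_imp_deriv)
  qed (simp add: G_def[abs_def])
  have F1: "(g z - w0) ^ n * deriv g z * exp (M (g z)) = deriv F z" for z
    by (simp add: deriv_F f')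
  have loc: "two_exponentials G M C w0 n (2 * norm a)"
  proof
    show "(G True z - w0) ^ n * deriv (G True) z * exp (M (G True z)) +
         (G False z - w0) ^ n * deriv (G False) z * exp (M (G False z)) = C z" for z
      using deriv_F_reflect[of z] unfolding dG C_def F1[symmetric] by (simp add: G_def)
    show "norm (C z) \<le> 2 * norm a * exp (norm z)" "norm (deriv C z) \<le> 2 * norm a * exp (norm z)" for z
      using norm_sin_cos_le_exp_norm[of z] unfolding dC C_def by (simp_all add: norm_mult mult_left_mono)
    show "C holomorphic_on UNIV" unfolding C_def by (intro holomorphic_intros)
  qed (use M holG in auto)
  \<comment> \<open>The condition that \<open>V_nonzero\<close> requires at the centre; if it failed
    everywhere, \<open>F'\<close> would be a multiple of the cosine.\<close>
  obtain p where p: "deriv (deriv F) p * C p \<noteq> deriv F p * deriv C p"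
  proof (rule ccontr)
    assume "\<not> thesis"
    hence W: "\<And>z. deriv (deriv F) z * C z = deriv F z * deriv C z" using that by blast
    define c where "c = deriv F 0 / C 0"
    have "deriv F z = c * C z" for z unfolding c_def
    proof (rule holomorphic_wronskian_zero_imp_proportional[OF _ _ W])
      show "deriv F holomorphic_on UNIV" using holomorphic_F by (intro holomorphic_deriv) auto
      show "C holomorphic_on UNIV" unfolding C_def by (intro holomorphic_intros)
      show "C 0 \<noteq> 0" using a_nonzero by (simp add: C_def)
    qed
    hence "deriv F z = (c * (2 * a)) * cos z" for z by (simp add: C_def mult_ac)
    thus False using deriv_F_not_cos by blast
  qed
  interpret E: two_exponentials G M C w0 p n "2 * norm a" by (rule loc)
  have "(\<lambda>z. E.A True z * exp (E.k True z)) = deriv F"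
    by (rule ext) (simp add: E.A_def E.k_def dG F1[symmetric], simp add: G_def)
  hence "E.V p \<noteq> 0" using p E.V_nonzero[of p] by (metis (no_types, lifting))
  then obtain c where "\<And>z. norm (M (G True z)) \<le> c * (1 + norm z)" using E.linear_growth by blast
  hence c: "norm (M (g z)) \<le> c * (1 + norm z)" for z by (simp add: G_def)
  have hMg: "(\<lambda>z. M (g z)) holomorphic_on UNIV"
    using holomorphic_on_compose_gen[OF hol_g M(1)] by (simp add: o_def)
  have "norm (M (g z)) \<le> (2 * \<bar>c\<bar>) * norm z ^ 1" if "1 \<le> norm z" for z
  proof -
    have "norm (M (g z)) \<le> \<bar>c\<bar> * (1 + norm z)" using c[of z] by (rule order_trans) (intro mult_right_mono, auto)
    also have "\<dots> \<le> \<bar>c\<bar> * (2 * norm z)" using that by (intro mult_left_mono) auto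
    finally show ?thesis by simp
  qed
  then obtain q :: "complex poly" where q: "\<And>z. M (g z) = poly q z" "degree q \<le> 1"
    using polynomial_growth_imp_poly[OF hMg] by metis
  define \<alpha> \<beta> where "\<alpha> = coeff q 1" and "\<beta> = coeff q 0"
  have "q = [:\<beta>, \<alpha>:]" using q(2)
    by (intro poly_eqI) (auto simp: coeff_pCons coeff_eq_0 \<alpha>_def \<beta>_def split: nat.splits)
  hence Mg: "M (g z) = \<beta> + z * \<alpha>" for z using q(1) by simp
  \<comment> \<open>Since \<open>M \<circ> g\<close> is affine with constant term
    \<open>\<beta>\<close>, the fibre of \<open>g\<close> over a \<open>w\<close> with
    \<open>M w \<noteq> \<beta>\<close> has at most one point, and none if
    \<open>\<alpha> = 0\<close>. Two such \<open>w\<close> contradict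
    \<open>transcendental_infinite_fibres\<close>.\<close>
  have "uncountable {w. M w \<noteq> \<beta>}"
  proof
    assume "countable {w. M w \<noteq> \<beta>}"
    moreover have "(UNIV :: complex set) = {w. M w \<noteq> \<beta>} \<union> {w. M w = \<beta>}" by blast
    ultimately have "uncountable {w. M w = \<beta>}" using uncountable_UNIV_complex by (metis countable_Un)
    hence "M = (\<lambda>_. \<beta>)" by (intro holomorphic_countable_equal_UNIV M(1)) auto
    thus False using M(2) by (auto simp: constant_on_def)
  qed
  hence inf: "infinite {w. M w \<noteq> \<beta>}" using countable_finite by blast
  hence "{w. M w \<noteq> \<beta>} \<noteq> {}" by (metis finite.emptyI)
  then obtain w1 where w1: "M w1 \<noteq> \<beta>" by blast
  have "infinite ({w. M w \<noteq> \<beta>} - {w1})" using inf by simp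
  hence "{w. M w \<noteq> \<beta>} - {w1} \<noteq> {}" by (metis finite.emptyI)
  then obtain w2 where w2: "M w2 \<noteq> \<beta>" "w1 \<noteq> w2" by blast
  have "finite {z. g z = w}" if "M w \<noteq> \<beta>" for w
  proof (cases "\<alpha> = 0")
    case True
    hence "g z \<noteq> w" for z using Mg[of z] that by auto
    thus ?thesis by simp
  next
    case False
    hence "{z. g z = w} \<subseteq> {(M w - \<beta>) / \<alpha>}" using Mg by (auto simp: field_simps)
    thus ?thesis using finite_subset by blast
  qed
  hence "finite {z. g z = w1 \<or> g z = w2}" using w1 w2 by (simp add: Collect_disj_eq)
  thus False using transcendental_infinite_fibres[OF hol_g tr w2(2)] by blast
qed

text \<open>Integration makes \<open>f\<close> a constant \<open>d\<close> plus a multiple of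
  \<open>(w - w0) ^ Suc n\<close>. If \<open>n > 0\<close>, only \<open>w0\<close> is sent to
  \<open>d\<close>, so all solutions of \<open>F z = d\<close> share one imaginary part, whereas
  \<open>F_attains_value\<close> yields solutions at different heights.\<close>

lemma power_derivative_imp_linear:
  assumes f': "\<And>w. deriv f w = (w - w0) ^ n * c" and c: "c \<noteq> 0"
  shows "linear_fun f"
proof -
  define r where "r w = c / of_nat (Suc n) * (w - w0) ^ Suc n" for w
  have "((\<lambda>w. f w - r w) has_field_derivative 0) (at w)" for w
  proof -
    have "(r has_field_derivative c / of_nat (Suc n) * (of_nat (Suc n) * (w - w0) ^ n)) (at w)"
      unfolding r_def by (rule derivative_eq_intros refl | simp del: of_nat_Suc)+
    hence "(r has_field_derivative deriv f w) (at w)" by (simp add: f' mult.commute del: of_nat_Suc)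
    from DERIV_diff[OF holomorphic_derivI[OF hol_f open_UNIV UNIV_I] this] show ?thesis by simp
  qed
  hence "(\<lambda>w. f w - r w) constant_on UNIV"
    using has_field_derivative_zero_constant[of UNIV "\<lambda>w. f w - r w"] by (auto simp: constant_on_def)
  then obtain d where d: "\<And>w. f w = d + r w" unfolding constant_on_def by (metis UNIV_I diff_add_cancel)
  show ?thesis
  proof (cases "n = 0")
    case True
    thus ?thesis unfolding linear_fun_def using c
      by (intro exI[of _ c] exI[of _ "d - c * w0"]) (simp add: d r_def algebra_simps)
  next
    case False
    have crit: "deriv F z = 0" if "F z = d" for z
    proof -
      have "g z = w0" using that c by (auto simp: F_eq d r_def simp del: of_nat_Suc)
      thus ?thesis using False by (simp add: deriv_F f')
    qed
    obtain z1 where z1: "F z1 = d" using F_attains_value by blast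
    obtain z2 where z2: "\<bar>Im z2\<bar> > \<bar>Im z1\<bar>" "F z2 = d" using F_attains_value by blast
    have "Im z1 = Im z2" using critical_Im crit z1 z2 by metis
    thus ?thesis using z2 by simp
  qed
qed

lemma factor_linear: "linear_fun f \<or> linear_fun g"
proof (rule ccontr)
  assume "\<not> ?thesis"
  hence nf: "\<not> linear_fun f" and ng: "\<not> linear_fun g" by auto
  have tr: "\<not> (\<exists>p. \<forall>z. g z = poly p z)" using polynomial_inner_factor_linear ng by blast
  have hol': "deriv f holomorphic_on UNIV" using hol_f by (intro holomorphic_deriv) auto
  obtain v where v: "deriv f v \<noteq> 0"
  proof (rule ccontr)
    assume "\<not> thesis"
    hence "deriv f z = 0" for z using that by blast
    hence "(f has_field_derivative 0) (at z)" for z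
      using holomorphic_derivI[OF hol_f open_UNIV UNIV_I, of z] by simp
    thus False using f_nonconstant has_field_derivative_zero_constant[of UNIV f] by (auto simp: constant_on_def)
  qed
  \<comment> \<open>If \<open>deriv f\<close> has no zeros, \<open>w0\<close> is arbitrary and the
    factorization below has \<open>n = 0\<close>.\<close>
  have "\<exists>w0. \<forall>w. deriv f w = 0 \<longrightarrow> w = w0"
    using two_critical_points_imp_false tr by metis
  then obtain w0 where w0: "\<And>w. deriv f w = 0 \<Longrightarrow> w = w0" by blast
  obtain n W where W: "W holomorphic_on UNIV" "W w0 \<noteq> 0" "\<And>z. deriv f z = (z - w0) ^ n * W z"
    using holomorphic_factor_power[OF hol' v] by blast
  have "W w \<noteq> 0" for w using W w0[of w] by auto
  then obtain M where M: "M holomorphic_on UNIV" "\<And>z. W z = exp (M z)"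
    using entire_zero_free_imp_exp W(1) by metis
  have f': "deriv f w = (w - w0) ^ n * exp (M w)" for w by (simp add: W(3) M(2))
  show False
  proof (cases "M constant_on UNIV")
    case True
    then obtain c where "\<And>w. M w = c" unfolding constant_on_def by auto
    thus False using power_derivative_imp_linear[of w0 n "exp c"] f' nf by simp
  next
    case False
    thus False using power_exp_derivative_imp_false M(1) f' tr by blast
  qed
qed

end

section \<open>The exceptional parameters and the conclusion\<close>

lemma deriv_cos_h_sin:
  fixes h :: "complex \<Rightarrow> complex"
  assumes "h holomorphic_on UNIV"
  shows "((\<lambda>z. cos z * h (sin z)) has_field_derivative
      (cos z)\<^sup>2 * deriv h (sin z) - sin z * h (sin z)) (at z)"
proof -
  have "((\<lambda>z. h (sin z)) has_field_derivative deriv h (sin z) * cos z) (at z)"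
    by (rule DERIV_chain2) (auto intro: holomorphic_derivI assms DERIV_sin)
  from DERIV_mult[OF DERIV_cos this] show ?thesis
    by (simp add: power2_eq_square algebra_simps)
qed

text \<open>Where the cosine vanishes, \<open>F'\<close> reduces to
  \<open>- sin z * h (sin z)\<close>, which is nonzero by the conditions on \<open>h\<close>; so
  \<open>nocoinc\<close> applies to all critical points. Equal sines still allow \<open>q\<close> to
  be congruent to \<open>\<pi> - p\<close>, but then the reflection identity for \<open>F'\<close>
  would give \<open>2 * a * cos p = 0\<close>.\<close>

lemma critical_points_congruent_mod_period:
  fixes h \<psi> :: "complex \<Rightarrow> complex" and a :: complex
  assumes \<psi>: "\<psi> = (\<lambda>z. cos z * h (sin z))"
    and "sin_composite h a" and "h 1 \<noteq> 0" "h (-1) \<noteq> 0"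
    and crit: "deriv \<psi> p + a * cos p = 0" "deriv \<psi> q + a * cos q = 0" and v: "\<psi> p + a * sin p = \<psi> q + a * sin q"
    and nocoinc: "\<And>p q. \<psi> p + a * sin p = \<psi> q + a * sin q \<Longrightarrow> deriv \<psi> p + a * cos p = 0 \<Longrightarrow>
      deriv \<psi> q + a * cos q = 0 \<Longrightarrow> cos p \<noteq> 0 \<Longrightarrow> cos q \<noteq> 0 \<Longrightarrow> sin p = sin q"
  shows "\<exists>k :: int. q = p + of_int k * (2 * of_real pi)"
proof -
  interpret sin_composite h a by fact
  have d: "(\<psi> has_field_derivative (cos z)\<^sup>2 * deriv h (sin z) - sin z * h (sin z)) (at z)" for z
    unfolding \<psi> by (rule deriv_cos_h_sin) (rule holomorphic_h)
  have dF: "deriv F z = deriv \<psi> z + a * cos z" for z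
  proof -
    have eq: "F = (\<lambda>z. \<psi> z + a * sin z)" by (simp add: F_def \<psi> fun_eq_iff)
    show ?thesis unfolding eq DERIV_imp_deriv[OF d]
      by (intro DERIV_imp_deriv DERIV_add d DERIV_cmult DERIV_sin)
  qed
  have cos: "cos z \<noteq> 0" if "deriv \<psi> z + a * cos z = 0" for z
  proof
    assume c: "cos z = 0"
    hence "(sin z)\<^sup>2 = 1" using sin_cos_squared_add[of z] by simp
    hence "sin z = 1 \<or> sin z = -1" by (simp add: power2_eq_1_iff)
    thus False using that c \<open>h 1 \<noteq> 0\<close> \<open>h (-1) \<noteq> 0\<close> by (auto simp: DERIV_imp_deriv[OF d])
  qed
  have "sin q = sin p" using nocoinc[OF v crit] cos crit by simp
  then obtain n where n: "n \<in> \<int>" "q = p + of_real (2 * n * pi) \<or> q = - p + of_real ((2 * n + 1) * pi)"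
    unfolding complex_sin_eq by blast
  from n(1) obtain k :: int where k: "n = of_int k" by (rule Ints_cases)
  from n(2) show ?thesis unfolding k
  proof
    assume "q = - p + of_real ((2 * of_int k + 1) * pi)"
    hence "q = (of_real pi - p) + of_int k * (2 * of_real pi)" by (simp add: algebra_simps)
    hence "deriv F (of_real pi - p) = 0" using crit(2) dF deriv_F_periodic_int by metis
    thus ?thesis using deriv_F_reflect[of p] crit(1) a_nonzero cos[OF crit(1)] by (simp add: dF)
  qed (auto simp: mult_ac)
qed

theorem theorem2p4:
  fixes h :: "complex \<Rightarrow> complex"
  assumes "transcendental_entire h" and "h 1 \<noteq> 0" and "h (-1) \<noteq> 0"
  shows "countable {a :: complex.
           \<not> prime_entire (\<lambda>z. cos z * h (sin z) + a * sin z)}"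
proof -
  define \<psi> where "\<psi> = (\<lambda>z. cos z * h (sin z))"
  have h: "h holomorphic_on UNIV" using assms(1) by (simp add: transcendental_entire_def entire_def)
  have d\<psi>: "(\<psi> has_field_derivative deriv \<psi> z) (at z)" for z
    using deriv_cos_h_sin[OF h, of z] DERIV_imp_deriv unfolding \<psi>_def by metis
  hence hol\<psi>: "\<psi> holomorphic_on UNIV" using holomorphic_on_open open_UNIV by blast
  have dsin: "deriv sin = (cos :: complex \<Rightarrow> complex)" by (rule ext) (rule DERIV_imp_deriv[OF DERIV_sin])
  \<comment> \<open>If this Wronskian vanished identically, \<open>deriv \<psi>\<close> would be a
    multiple of the cosine, and so would \<open>F'\<close> for the parameter 1, against
    \<open>deriv_F_not_cos\<close>.\<close>
  have "\<exists>z0. deriv (deriv \<psi>) z0 * deriv sin z0 \<noteq> deriv \<psi> z0 * deriv (deriv sin) z0"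
  proof (rule ccontr)
    assume no: "\<not> ?thesis"
    interpret sin_composite h 1 by unfold_locales (use assms(1) in auto)
    define c where "c = deriv \<psi> 0 / deriv sin 0"
    have "deriv \<psi> z = c * deriv sin z" for z unfolding c_def
      by (rule holomorphic_wronskian_zero_imp_proportional)
         (use no hol\<psi> in \<open>auto intro!: holomorphic_deriv simp: dsin holomorphic_on_cos\<close>)
    hence "deriv \<psi> z = c * cos z" for z by (simp only: dsin)
    moreover have "F = (\<lambda>z. \<psi> z + sin z)" by (simp add: F_def \<psi>_def fun_eq_iff)
    moreover have "deriv (\<lambda>z. \<psi> z + sin z) z = deriv \<psi> z + cos z" for z
      by (intro DERIV_imp_deriv DERIV_add d\<psi> DERIV_sin)
    ultimately have "deriv F z = (c + 1) * cos z" for z by (simp add: algebra_simps)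
    thus False using deriv_F_not_cos by blast
  qed
  then obtain z0 where z0: "deriv (deriv \<psi>) z0 * deriv sin z0 \<noteq> deriv \<psi> z0 * deriv (deriv sin) z0" by blast
  define Bad where "Bad = {a. \<exists>p q. \<psi> p + a * sin p = \<psi> q + a * sin q
           \<and> deriv \<psi> p + a * deriv sin p = 0 \<and> deriv \<psi> q + a * deriv sin q = 0
           \<and> deriv sin p \<noteq> 0 \<and> deriv sin q \<noteq> 0 \<and> sin p \<noteq> sin q}"
  have "countable Bad"
    unfolding Bad_def by (rule countable_coinciding_critical_values[OF hol\<psi> holomorphic_on_sin z0])
  moreover have "{a. \<not> prime_entire (\<lambda>z. cos z * h (sin z) + a * sin z)} \<subseteq> insert 0 Bad"
  proof (intro subsetI, rule ccontr)
    fix a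
    assume "a \<in> {a. \<not> prime_entire (\<lambda>z. cos z * h (sin z) + a * sin z)}" and a: "a \<notin> insert 0 Bad"
    then obtain f g where fg: "entire f" "entire g" "(\<lambda>z. cos z * h (sin z) + a * sin z) = f \<circ> g"
      "\<not> linear_fun f" "\<not> linear_fun g"
      unfolding prime_entire_def by blast
    have loc: "sin_composite h a" by unfold_locales (use assms(1) a in auto)
    interpret S: sin_composite h a by (rule loc)
    have F: "S.F z = \<psi> z + a * sin z" for z by (simp add: S.F_def \<psi>_def)
    have dF: "deriv S.F z = deriv \<psi> z + a * cos z" for z
      unfolding ext[of S.F, OF F] by (intro DERIV_imp_deriv DERIV_add d\<psi> DERIV_cmult DERIV_sin)
    interpret factorized_sin_composite h a f g
    proof
      show "f holomorphic_on UNIV" "g holomorphic_on UNIV" using fg by (simp_all add: entire_def)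
      show "S.F z = f (g z)" for z using fun_cong[OF fg(3), of z] by (simp add: S.F_def)
      have nocoinc: "\<psi> p + a * sin p = \<psi> q + a * sin q \<Longrightarrow> deriv \<psi> p + a * cos p = 0 \<Longrightarrow>
          deriv \<psi> q + a * cos q = 0 \<Longrightarrow> cos p \<noteq> 0 \<Longrightarrow> cos q \<noteq> 0 \<Longrightarrow> sin p = sin q" for p q
        using a unfolding Bad_def dsin by blast
      show "\<exists>k :: int. q = p + of_int k * (2 * of_real pi)"
        if "S.F p = S.F q" "deriv S.F p = 0" "deriv S.F q = 0" for p q
      proof (rule critical_points_congruent_mod_period[OF \<psi>_def loc assms(2,3)])
        show "\<psi> p + a * sin p = \<psi> q + a * sin q" using that(1) by (simp only: F)
        show "deriv \<psi> p + a * cos p = 0" "deriv \<psi> q + a * cos q = 0" using that(2,3) by (simp_all only: dF)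
      qed (fact nocoinc)
    qed
    show False using factor_linear fg(4,5) by blast
  qed
  ultimately show ?thesis by (meson countable_insert countable_subset)
qed

end
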